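(* Let $\sigma$ be a complex polynomial of degree $\le 2$, $\sigma\neq 0$, and $\kappa$ a complex polynomial of degree $\le 1$. On $\mathbb{C}^3$ with coordinates $(t,s,z)$ (on $t\neq0$) put $$N:=t\partial_t-s\partial_s,\qquad A_+:=t\partial_z+\sigma'(z)\partial_s,\qquad A_-:=s\partial_z+\sigma'(z)\partial_t+\frac{\kappa(z)}{t}.$$ Then: (i) $[N,A_+]=A_+$, $[N,A_-]=-A_-$, $[A_+,A_-]=\sigma''N+\kappa'\mathbb{1}$, so that $N,A_+,A_-,\mathbb 1$ give a representation of the Lie algebra $m_{\alpha,\beta}$ with $\alpha=\frac{\sigma''}{2}$, $\beta=\kappa'$. (ii) $N,A_+,A_-$ commute with the operator of multiplication by $\sigma(z)-ts$; hence they restrict to analytic functions on $\Omega$. In the coordinates $w=t$, $z$ on $\Omega$, the restricted operators are $$N=w\partial_w,\qquad A_+=w\partial_z,\qquad A_-=\frac1w\big(\sigma(z)\partial_z+\sigma'(z)w\partial_w+\kappa(z)\big).$$ (iii) The Casimir operator of the restricted representation is $$\mathcal{C}=\sigma(z)\partial_z^2+\big(\kappa(z)+\sigma'(z)(w\partial_w+1)\big)\partial_z+\frac{\sigma''}{2}w\partial_w(w\partial_w+1)+\kappa'\big(w\partial_w+\tfrac12\big).$$ In particular, restricted to the eigenspace $N=0$ (functions depending on $z$ only) it equals $$\mathcal{H}(\sigma,\kappa)=\sigma(z)\partial_z^2+\big(\sigma'(z)+\kappa(z)\big)\partial_z+\tfrac12\kappa'.$$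
   Context: For $\alpha,\beta\in\mathbb{C}$, $m_{\alpha,\beta}$ is the complex Lie algebra spanned by $N,A_+,A_-,\mathbb 1$ with $[N,A_\pm]=\pm A_\pm$, $[A_+,A_-]=2\alpha N+\beta\mathbb 1$, and $\mathbb 1$ central. In a representation of $m_{\alpha,\beta}$ (with $\mathbb 1$ acting as the identity) its Casimir operator is $$\mathcal C:=\tfrac12(A_-A_++A_+A_-)+\alpha N^2+\beta N=A_-A_++\alpha N(N+1)+\beta(N+\tfrac12).$$ $\Omega$ denotes the universal cover of the manifold $\{(t,s,z)\in\mathbb{C}^3:\ \sigma(z)-ts=0,\ t\neq0,\ s\neq0\}$. Since $s=\sigma(z)/t$ on this manifold, $(w,z)$ with $w=t$ are (local) coordinates on $\Omega$. Primes denote derivatives in $z$; $\sigma''$ and $\kappa'$ are constants. *)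

theory Defs
  imports "HOL-Complex_Analysis.Complex_Analysis"
begin

text \<open>The symbol \<open>$\<close> is to denote vector components only.\<close>

no_notation fps_nth (infixl \<open>$\<close> 75)


section \<open>Analytic functions of several complex variables\<close>

text \<open>
  For open \<open>U\<close> this is the space of analytic functions on \<open>U\<close>: functions that are Frechet
  differentiable with complex linear derivative at each point. Functions are total; their values
  outside \<open>U\<close> carry no information, so functions on \<open>U\<close> are always compared pointwise on \<open>U\<close>.
\<close>

definition hol :: "(complex^'n) set \<Rightarrow> (complex^'n \<Rightarrow> complex) set" where
  "hol U = {F. \<forall>x\<in>U. \<exists>L. (F has_derivative L) (at x) \<and> (\<forall>c v. L (c *s v) = c * L v)}"

definition pd :: "'n \<Rightarrow> (complex^'n \<Rightarrow> complex) \<Rightarrow> complex^'n \<Rightarrow> complex" where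
  "pd i F x = deriv (\<lambda>h. F (x + axis i h)) 0"


section \<open>The Lie algebra and its representations by operators on functions\<close>

text \<open>
  The vector \<open>X\<close> stands for \<open>X$1 N + X$2 A\<^sub>+ + X$3 A\<^sub>- + X$4 \<one>\<close>.
\<close>

definition m_bracket :: "complex \<Rightarrow> complex \<Rightarrow> complex^4 \<Rightarrow> complex^4 \<Rightarrow> complex^4" where
  "m_bracket \<alpha> \<beta> X Y = vector
     [2 * \<alpha> * (X$2 * Y$3 - X$3 * Y$2),
      X$1 * Y$2 - X$2 * Y$1,
      - (X$1 * Y$3 - X$3 * Y$1),
      \<beta> * (X$2 * Y$3 - X$3 * Y$2)]"

lemma vector_4 [simp]:
  "(vector [a,b,c,d] :: 'a::zero^4) $ 1 = a" "(vector [a,b,c,d] :: 'a::zero^4) $ 2 = b"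
  "(vector [a,b,c,d] :: 'a::zero^4) $ 3 = c" "(vector [a,b,c,d] :: 'a::zero^4) $ 4 = d"
  unfolding vector_def by simp_all

lemma m_bracket_generators:
  "m_bracket \<alpha> \<beta> (axis 1 1) (axis 2 1) = axis 2 1"
  "m_bracket \<alpha> \<beta> (axis 1 1) (axis 3 1) = - axis 3 1"
  "m_bracket \<alpha> \<beta> (axis 2 1) (axis 3 1) = (2 * \<alpha>) *s axis 1 1 + \<beta> *s axis 4 1"
  "m_bracket \<alpha> \<beta> (axis 4 1) Y = 0"
  by (simp_all add: m_bracket_def vec_eq_iff forall_4 axis_def)

lemma m_bracket_lie:
  "m_bracket \<alpha> \<beta> (a *s X + b *s Y) Z = a *s m_bracket \<alpha> \<beta> X Z + b *s m_bracket \<alpha> \<beta> Y Z"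
  "m_bracket \<alpha> \<beta> X X = 0"
  "m_bracket \<alpha> \<beta> X Y = - m_bracket \<alpha> \<beta> Y X"
  "m_bracket \<alpha> \<beta> X (m_bracket \<alpha> \<beta> Y Z) + m_bracket \<alpha> \<beta> Y (m_bracket \<alpha> \<beta> Z X)
     + m_bracket \<alpha> \<beta> Z (m_bracket \<alpha> \<beta> X Y) = 0"
  by (simp_all add: m_bracket_def vec_eq_iff forall_4 algebra_simps)

type_synonym 'x operator = "('x \<Rightarrow> complex) \<Rightarrow> 'x \<Rightarrow> complex"

definition commutator :: "'x operator \<Rightarrow> 'x operator \<Rightarrow> 'x operator" where
  "commutator D E F x = D (E F) x - E (D F) x"

definition m_action :: "'x operator \<Rightarrow> 'x operator \<Rightarrow> 'x operator \<Rightarrow> complex^4 \<Rightarrow> 'x operator" where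
  "m_action N P M X F x = X$1 * N F x + X$2 * P F x + X$3 * M F x + X$4 * F x"

text \<open>
  \<open>\<rho>\<close> is a representation on the space \<open>V\<close> of functions on \<open>S\<close>, with the central element acting
  as the identity.
\<close>

definition m_representation ::
  "complex \<Rightarrow> complex \<Rightarrow> 'x set \<Rightarrow> ('x \<Rightarrow> complex) set \<Rightarrow> (complex^4 \<Rightarrow> 'x operator) \<Rightarrow> bool" where
  "m_representation \<alpha> \<beta> S V \<rho> \<longleftrightarrow>
     (\<forall>X. \<forall>F\<in>V. \<rho> X F \<in> V) \<and>
     (\<forall>X. \<forall>F\<in>V. \<forall>G\<in>V. (\<forall>x\<in>S. F x = G x) \<longrightarrow> (\<forall>x\<in>S. \<rho> X F x = \<rho> X G x)) \<and>
     (\<forall>X a b. \<forall>F\<in>V. \<forall>G\<in>V. \<forall>x\<in>S. \<rho> X (\<lambda>y. a * F y + b * G y) x = a * \<rho> X F x + b * \<rho> X G x) \<and>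
     (\<forall>X Y a b. \<forall>F\<in>V. \<forall>x\<in>S. \<rho> (a *s X + b *s Y) F x = a * \<rho> X F x + b * \<rho> Y F x) \<and>
     (\<forall>X Y. \<forall>F\<in>V. \<forall>x\<in>S. \<rho> (m_bracket \<alpha> \<beta> X Y) F x = commutator (\<rho> X) (\<rho> Y) F x) \<and>
     (\<forall>F\<in>V. \<forall>x\<in>S. \<rho> (axis 4 1) F x = F x)"

definition casimir ::
  "complex \<Rightarrow> complex \<Rightarrow> 'x operator \<Rightarrow> 'x operator \<Rightarrow> 'x operator \<Rightarrow> 'x operator" where
  "casimir \<alpha> \<beta> N P M F x =
     1/2 * (M (P F) x + P (M F) x) + \<alpha> * N (N F) x + \<beta> * N F x"


section \<open>The operators on three-dimensional space\<close>

text \<open>Coordinates: \<open>t = v$1\<close>, \<open>s = v$2\<close>, \<open>z = v$3\<close>.\<close>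

abbreviation deriv_poly :: "complex poly \<Rightarrow> complex \<Rightarrow> complex" where
  "deriv_poly q \<equiv> poly (pderiv q)"

text \<open>The constants \<open>\<sigma>''\<close> (for \<open>degree \<sigma> \<le> 2\<close>) and \<open>\<kappa>'\<close> (for \<open>degree \<kappa> \<le> 1\<close>).\<close>

definition const_deriv2 :: "complex poly \<Rightarrow> complex" where
  "const_deriv2 \<sigma> = coeff (pderiv (pderiv \<sigma>)) 0"

definition const_deriv :: "complex poly \<Rightarrow> complex" where
  "const_deriv \<kappa> = coeff (pderiv \<kappa>) 0"

lemma pderiv2_eq_const_deriv2: "degree \<sigma> \<le> 2 \<Longrightarrow> pderiv (pderiv \<sigma>) = [:const_deriv2 \<sigma>:]"
  unfolding const_deriv2_def by (rule degree_0_id [symmetric]) (simp add: degree_pderiv)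

lemma pderiv_eq_const_deriv: "degree \<kappa> \<le> 1 \<Longrightarrow> pderiv \<kappa> = [:const_deriv \<kappa>:]"
  unfolding const_deriv_def by (rule degree_0_id [symmetric]) (simp add: degree_pderiv)

definition t_nonzero :: "(complex^3) set" where
  "t_nonzero = {v. v$1 \<noteq> 0}"

definition N_op :: "(complex^3) operator" where
  "N_op F v = v$1 * pd 1 F v - v$2 * pd 2 F v"

definition Ap_op :: "complex poly \<Rightarrow> (complex^3) operator" where
  "Ap_op \<sigma> F v = v$1 * pd 3 F v + deriv_poly \<sigma> (v$3) * pd 2 F v"

definition Am_op :: "complex poly \<Rightarrow> complex poly \<Rightarrow> (complex^3) operator" where
  "Am_op \<sigma> \<kappa> F v = v$2 * pd 3 F v + deriv_poly \<sigma> (v$3) * pd 1 F v + poly \<kappa> (v$3) / v$1 * F v"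

definition quadric :: "complex poly \<Rightarrow> complex^3 \<Rightarrow> complex" where
  "quadric \<sigma> v = poly \<sigma> (v$3) - v$1 * v$2"


section \<open>The universal cover and restriction of operators to it\<close>

definition quadric_manifold :: "complex poly \<Rightarrow> (complex^3) set" where
  "quadric_manifold \<sigma> = {v. quadric \<sigma> v = 0 \<and> v$1 \<noteq> 0 \<and> v$2 \<noteq> 0}"

definition universal_cover ::
  "'a::topological_space set \<Rightarrow> ('a \<Rightarrow> 'b) \<Rightarrow> 'b::topological_space set \<Rightarrow> bool" where
  "universal_cover \<Omega> p S \<longleftrightarrow> covering_space \<Omega> p S \<and> simply_connected \<Omega>"

text \<open>
  On the open subset \<open>U\<close> of \<open>\<Omega>\<close>, the function \<open>f\<close> is the pullback under \<open>p\<close> of the analytic function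
  \<open>F\<close> defined on the open subset \<open>V\<close> of \<open>\<complex>\<^sup>3\<close>.
\<close>

definition local_extension ::
  "'a::topological_space set \<Rightarrow> ('a \<Rightarrow> complex^3) \<Rightarrow> ('a \<Rightarrow> complex) \<Rightarrow>
     'a set \<Rightarrow> (complex^3) set \<Rightarrow> (complex^3 \<Rightarrow> complex) \<Rightarrow> bool" where
  "local_extension \<Omega> p f U V F \<longleftrightarrow>
     openin (top_of_set \<Omega>) U \<and> open V \<and> V \<subseteq> t_nonzero \<and> p ` U \<subseteq> V \<and> F \<in> hol V \<and>
     (\<forall>y\<in>U. f y = F (p y))"

text \<open>
  The complex structure of \<open>\<Omega>\<close> is pulled back along \<open>p\<close> from the complex submanifold of \<open>\<complex>\<^sup>3\<close>, on
  which the analytic functions are locally the restrictions of analytic functions of the ambient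
  space.
\<close>

definition hol_cover :: "'a::topological_space set \<Rightarrow> ('a \<Rightarrow> complex^3) \<Rightarrow> ('a \<Rightarrow> complex) set" where
  "hol_cover \<Omega> p = {f. \<forall>x\<in>\<Omega>. \<exists>U V F. x \<in> U \<and> local_extension \<Omega> p f U V F}"

text \<open>
  Apply \<open>D\<close> to any local analytic extension. That the result does not depend on the extension (so
  that the definite description is meaningful) is the content of \<open>restricts\<close>.
\<close>

definition restriction ::
  "'a::topological_space set \<Rightarrow> ('a \<Rightarrow> complex^3) \<Rightarrow> (complex^3) operator \<Rightarrow> 'a operator" where
  "restriction \<Omega> p D f x =
     (THE d. \<exists>U V F. x \<in> U \<and> local_extension \<Omega> p f U V F \<and> d = D F (p x))"

definition restricts ::
  "'a::topological_space set \<Rightarrow> ('a \<Rightarrow> complex^3) \<Rightarrow> (complex^3) operator \<Rightarrow> bool" where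
  "restricts \<Omega> p D \<longleftrightarrow>
     (\<forall>f\<in>hol_cover \<Omega> p. restriction \<Omega> p D f \<in> hol_cover \<Omega> p \<and>
        (\<forall>U V F. local_extension \<Omega> p f U V F \<longrightarrow> (\<forall>x\<in>U. restriction \<Omega> p D f x = D F (p x))))"


section \<open>The coordinates \<open>(w, z)\<close>\<close>

definition wz :: "('a \<Rightarrow> complex^3) \<Rightarrow> 'a \<Rightarrow> complex^2" where
  "wz p x = vector [p x $ 1, p x $ 3]"

text \<open>\<open>\<psi>\<close> is the inverse of \<open>(w, z)\<close> on \<open>U\<close>; a function \<open>f\<close> reads \<open>f \<circ> \<psi>\<close> in the coordinates.\<close>

definition wz_chart ::
  "'a::topological_space set \<Rightarrow> ('a \<Rightarrow> complex^3) \<Rightarrow> 'a set \<Rightarrow> (complex^2) set \<Rightarrow> (complex^2 \<Rightarrow> 'a) \<Rightarrow> bool"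
where
  "wz_chart \<Omega> p U W \<psi> \<longleftrightarrow> openin (top_of_set \<Omega>) U \<and> open W \<and> homeomorphism U W (wz p) \<psi>"

text \<open>Coordinate expressions: \<open>w = u$1\<close>, \<open>z = u$2\<close>.\<close>

definition N_wz :: "(complex^2) operator" where
  "N_wz G u = u$1 * pd 1 G u"

definition Ap_wz :: "(complex^2) operator" where
  "Ap_wz G u = u$1 * pd 2 G u"

definition Am_wz :: "complex poly \<Rightarrow> complex poly \<Rightarrow> (complex^2) operator" where
  "Am_wz \<sigma> \<kappa> G u =
     1 / u$1 * (poly \<sigma> (u$2) * pd 2 G u + deriv_poly \<sigma> (u$2) * (u$1 * pd 1 G u) + poly \<kappa> (u$2) * G u)"

definition casimir_wz :: "complex poly \<Rightarrow> complex poly \<Rightarrow> (complex^2) operator" where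
  "casimir_wz \<sigma> \<kappa> G u =
     poly \<sigma> (u$2) * pd 2 (pd 2 G) u
     + (poly \<kappa> (u$2) * pd 2 G u
        + deriv_poly \<sigma> (u$2) * (u$1 * pd 1 (pd 2 G) u + pd 2 G u))
     + const_deriv2 \<sigma> / 2 * (u$1 * pd 1 (\<lambda>v. v$1 * pd 1 G v + G v) u)
     + const_deriv \<kappa> * (u$1 * pd 1 G u + 1/2 * G u)"

definition H_op :: "complex poly \<Rightarrow> complex poly \<Rightarrow> complex operator" where
  "H_op \<sigma> \<kappa> h z =
     poly \<sigma> z * deriv (deriv h) z + (deriv_poly \<sigma> z + poly \<kappa> z) * deriv h z
     + 1/2 * const_deriv \<kappa> * h z"

text \<open>
  On \<open>U\<close>, the function \<open>f\<close> is the analytic function \<open>h\<close> of the coordinate \<open>z\<close> alone. Since \<open>z\<close> is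
  only a local coordinate on \<open>\<Omega>\<close>, dependence on \<open>z\<close> alone is a local notion.
\<close>

definition function_of_z ::
  "'a::topological_space set \<Rightarrow> ('a \<Rightarrow> complex^3) \<Rightarrow> ('a \<Rightarrow> complex) \<Rightarrow>
     'a set \<Rightarrow> complex set \<Rightarrow> (complex \<Rightarrow> complex) \<Rightarrow> bool" where
  "function_of_z \<Omega> p f U Z h \<longleftrightarrow>
     openin (top_of_set \<Omega>) U \<and> open Z \<and> (\<forall>y\<in>U. p y $ 3 \<in> Z) \<and> h holomorphic_on Z \<and>
     (\<forall>y\<in>U. f y = h (p y $ 3))"

end

(* Partial derivatives of a holomorphic function of several variables are again holomorphic and
   commute: both follow by differentiating Cauchy's formula on a circle under the integral sign.
   The quadric is the graph s = sigma(z)/t, so (w, z) is a chart of the covering space, and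
   analytic functions on it locally extend to C^3 by functions independent of s.  By the chain
   rule N, A+ and A- at a point of the graph depend only on the function restricted to the graph;
   this gives the well-definedness of the restrictions and their expressions in (w, z), from which
   the Casimir operator is computed directly. *)
theory Submission
  imports Defs
begin

section \<open>Complex differentiability in several variables\<close>

text \<open>\<open>hol\<close> asks for a complex linear Frechet derivative at each point and says
  nothing about continuity of the partial derivatives, whereas commutators and the Casimir operator
  are of second order. Regularity therefore has to be established before anything else. Cauchy's
  formula can provide it because the circle is fixed and the point enters only through the
  integrand. On the covering space the difficulty is that \<open>restriction\<close> is a definite
  description ranging over all local extensions. It is resolved by an equality between
  \<open>D F (p x)\<close> and an expression in \<open>f \<circ> \<psi>\<close> alone. Both sides of
  it are then exploited: the bracket relations are inherited from three-space, since
  \<open>D F\<close> again extends the restriction of \<open>D\<close> applied to \<open>f\<close>,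
  while explicit formulas are computed in charts. Functions are total and only their values on an
  open set count, so a function under a derivative may be replaced only by one that agrees with it
  on a whole neighbourhood. This accounts for the many congruence steps.\<close>

definition cdiff_at :: "(complex^'n \<Rightarrow> complex) \<Rightarrow> complex^'n \<Rightarrow> bool" where
  "cdiff_at F x \<longleftrightarrow> (\<exists>L. (F has_derivative L) (at x) \<and> (\<forall>c v. L (c *s v) = c * L v))"

lemma hol_iff_cdiff_at: "F \<in> hol U \<longleftrightarrow> (\<forall>x\<in>U. cdiff_at F x)"
  by (simp add: hol_def cdiff_at_def)

lemma norm_axis: "norm (axis i h :: complex^'n) = norm h"
  by (simp add: norm_vec_def L2_set_def axis_def if_distrib[of norm] if_distrib[of "\<lambda>x. x^2"] cong: if_cong)

lemma axis_zero [simp]: "axis i 0 = 0"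
  by simp

lemma bounded_linear_axis: "bounded_linear (axis i :: complex \<Rightarrow> complex^'n)"
  by (rule bounded_linear_intro[where K=1])
    (auto simp: axis_def vec_eq_iff norm_axis[unfolded axis_def])

text \<open>Chain rule along the complex line in direction \<open>axis i\<close>. Complex linearity
  of \<open>L\<close> turns \<open>L (axis i h)\<close> into \<open>L (axis i 1) * h\<close>; a
  merely real linear \<open>L\<close> need not give a complex derivative.\<close>

lemma pd_DERIV:
  fixes x :: "complex^'n"
  assumes "(F has_derivative L) (at x)" "\<And>c v. L (c *s v) = c * L v"
  shows "((\<lambda>h. F (x + axis i h)) has_field_derivative L (axis i 1)) (at 0)"
proof -
  have "((\<lambda>h. x + axis i h) has_derivative axis i) (at 0)"
    using has_derivative_add[OF _ bounded_linear_imp_has_derivative[OF bounded_linear_axis],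
        of "\<lambda>_. x" "\<lambda>_. 0" "at 0" i] by simp
  moreover have "(F has_derivative L) (at (x + axis i 0))"
    using assms(1) by simp
  ultimately have "((\<lambda>h. F (x + axis i h)) has_derivative (\<lambda>h. L (axis i h))) (at 0)"
    by (rule has_derivative_compose)
  moreover have "(\<lambda>h. L (axis i h)) = (*) (L (axis i 1))"
  proof
    fix h :: complex
    have "(axis i h :: complex^'n) = h *s axis i 1"
      by (simp add: vec_eq_iff axis_def)
    then show "L (axis i h) = L (axis i 1) * h" by (metis assms(2) mult.commute)
  qed
  ultimately show ?thesis
    by (simp only: has_field_derivative_def)
qed

lemma pd_eq:
  fixes x :: "complex^'n"
  assumes "(F has_derivative L) (at x)" "\<And>c v. L (c *s v) = c * L v"
  shows "pd i F x = L (axis i 1)"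
  unfolding pd_def using DERIV_imp_deriv[OF pd_DERIV[OF assms]] .

lemma cdiff_at_has_derivative:
  assumes "cdiff_at F x"
  shows "(F has_derivative (\<lambda>v. \<Sum>j\<in>UNIV. v$j * pd j F x)) (at x)"
proof -
  obtain L where L: "(F has_derivative L) (at x)" "\<And>c v. L (c *s v) = c * L v"
    using assms by (auto simp: cdiff_at_def)
  interpret L: bounded_linear L by (rule has_derivative_bounded_linear[OF L(1)])
  have "L = (\<lambda>v. \<Sum>j\<in>UNIV. v$j * pd j F x)"
  proof
    fix v
    have "L v = L (\<Sum>j\<in>UNIV. (v$j) *s axis j 1)" by (simp add: basis_expansion)
    also have "\<dots> = (\<Sum>j\<in>UNIV. v$j * L (axis j 1))" by (simp add: L.sum L(2))
    finally show "L v = (\<Sum>j\<in>UNIV. v$j * pd j F x)" by (simp add: pd_eq[OF L])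
  qed
  then show ?thesis using L(1) by simp
qed

text \<open>A derivative of this shape is complex linear automatically. Together with
  \<open>cdiff_at_has_derivative\<close> it reduces each calculus rule below to the corresponding
  \<open>has_derivative\<close> rule followed by collecting coefficients of
  \<open>v$j\<close>.\<close>

lemma cdiff_at_gradientI:
  assumes "(F has_derivative (\<lambda>v. \<Sum>j\<in>UNIV. v$j * D j)) (at x)"
  shows "cdiff_at F x" "pd i F x = D i"
proof -
  have lin: "(\<Sum>j\<in>UNIV. (c *s v)$j * D j) = c * (\<Sum>j\<in>UNIV. v$j * D j)" for c v
    by (simp add: sum_distrib_left mult.assoc)
  show "cdiff_at F x" unfolding cdiff_at_def using assms lin by blast
  show "pd i F x = D i"
    by (simp add: pd_eq[OF assms lin] axis_def if_distrib[of "\<lambda>x. x * _"] cong: if_cong)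
qed

text \<open>\<open>pd\<close> differentiates at parameter 0. Shifting the base point along the line
  makes the whole slice a one-variable function with known derivative, so that one-variable theorems
  apply to it.\<close>

lemma cdiff_at_DERIV:
  assumes "cdiff_at F (x + axis i a)"
  shows "((\<lambda>h. F (x + axis i h)) has_field_derivative pd i F (x + axis i a)) (at a)"
proof -
  obtain L where L: "(F has_derivative L) (at (x + axis i a))" "\<And>c v. L (c *s v) = c * L v"
    using assms by (auto simp: cdiff_at_def)
  have "((\<lambda>h. F (x + axis i a + axis i h)) has_field_derivative pd i F (x + axis i a)) (at 0)"
    using pd_DERIV[OF L] pd_eq[OF L] by simp
  moreover have "x + axis i a + axis i h = x + axis i (h + a)" for h
    by (simp add: vec_eq_iff axis_def)
  ultimately show ?thesis
    using DERIV_shift[of "\<lambda>h. F (x + axis i h)" _ 0 a] by simp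
qed

lemma cdiff_at_imp_continuous: "cdiff_at F x \<Longrightarrow> isCont F x"
  by (auto simp: cdiff_at_def intro: has_derivative_continuous)

lemma hol_imp_continuous_on: "F \<in> hol U \<Longrightarrow> continuous_on U F"
  by (auto simp: hol_iff_cdiff_at intro!: continuous_at_imp_continuous_on cdiff_at_imp_continuous)

section \<open>Cauchy's formula: partial derivatives are holomorphic and commute\<close>

lemma pd_Cauchy:
  assumes F: "F \<in> hol U" and r: "r > 0" and sub: "cball x r \<subseteq> U"
  shows "pd i F x = integral {0..1} (\<lambda>t. F (x + axis i (circlepath 0 r t)) / circlepath 0 r t)"
proof -
  have inU: "x + axis i h \<in> U" if "h \<in> cball 0 r" for h
    using that sub by (auto simp: dist_norm norm_axis intro!: subsetD[OF sub])
  have D: "((\<lambda>h. F (x + axis i h)) has_field_derivative pd i F (x + axis i a)) (at a)"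
    if "a \<in> cball 0 r" for a
    using inU[OF that] F by (intro cdiff_at_DERIV) (auto simp: hol_iff_cdiff_at)
  have x0: "x + axis i 0 = x" by (simp add: vec_eq_iff axis_def)
  let ?g = "\<lambda>h. F (x + axis i h)"
  have c: "continuous_on (cball 0 r) ?g"
    using D by (meson DERIV_isCont continuous_at_imp_continuous_on)
  have h: "?g holomorphic_on ball 0 r"
    using D by (intro holomorphic_onI)
      (meson ball_subset_cball field_differentiable_at_within field_differentiable_def subsetD)
  have "pd i F x = 1 / (2 * of_real pi * \<i>) * contour_integral (circlepath 0 r) (\<lambda>u. ?g u / (u-0)^2)"
    using DERIV_unique[OF D[of 0] Cauchy_derivative_integral_circlepath(2)[OF c h, of 0]] r x0 by simp
  also have "\<dots> = integral {0..1} (\<lambda>t. 1 / (2 * of_real pi * \<i>) *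
      (?g (circlepath 0 r t) / (circlepath 0 r t)^2 * vector_derivative (circlepath 0 r) (at t)))"
    by (subst integral_mult_right) (simp add: contour_integral_integral)
  \<comment> \<open>The circle c satisfies c' = 2 pi i c, which cancels the prefactor and one of the
    two factors c in the denominator.\<close>
  also have "\<dots> = integral {0..1} (\<lambda>t. ?g (circlepath 0 r t) / circlepath 0 r t)"
  proof (intro integral_cong)
    fix t :: real
    have "vector_derivative (circlepath 0 r) (at t) = 2 * of_real pi * \<i> * circlepath 0 r t"
      unfolding vector_derivative_circlepath by (simp add: circlepath)
    moreover have "circlepath 0 r t \<noteq> 0" using r by (simp add: circlepath)
    ultimately show "1 / (2 * of_real pi * \<i>) *
      (?g (circlepath 0 r t) / (circlepath 0 r t)^2 * vector_derivative (circlepath 0 r) (at t))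
      = ?g (circlepath 0 r t) / circlepath 0 r t"
      by (simp add: power2_eq_square)
  qed
  finally show ?thesis .
qed

lemma circlepath_ne: "r > 0 \<Longrightarrow> circlepath 0 r t \<noteq> 0"
  by (simp add: circlepath)

lemma norm_circlepath: "r > 0 \<Longrightarrow> norm (circlepath 0 r t) = r"
  by (simp add: circlepath norm_mult)

text \<open>Joint continuity is what the theorems on parametric integrals ask for. The factor 2 is
  there because a point within r of \<open>x0\<close>, moved by r along an axis, stays within 2r of
  \<open>x0\<close>.\<close>

lemma continuous_on_shifted_circle:
  fixes x0 :: "complex^'n"
  assumes "continuous_on U G" and r: "r > 0" and sub: "cball x0 (2*r) \<subseteq> U"
  shows "continuous_on (ball x0 r \<times> cbox 0 1)
    (\<lambda>(x,t). G (x + axis i (circlepath 0 r t)) / circlepath 0 r t)"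
proof -
  have ax: "continuous_on S (axis i :: complex \<Rightarrow> complex^'n)" for S
    using bounded_linear_axis linear_continuous_on by blast
  have ci: "continuous_on (ball x0 r \<times> cbox 0 1) (\<lambda>y. circlepath 0 r (snd y))"
    unfolding circlepath by (intro continuous_intros)
  have sh: "continuous_on (ball x0 r \<times> cbox 0 1) (\<lambda>y. fst y + axis i (circlepath 0 r (snd y)))"
    by (intro continuous_intros continuous_on_compose2[OF ax[of UNIV] ci]) auto
  have "fst y + axis i (circlepath 0 r (snd y)) \<in> U" if "y \<in> ball x0 r \<times> cbox 0 1" for y
  proof (rule subsetD[OF sub])
    have "dist x0 (fst y + axis i (circlepath 0 r (snd y)))
        \<le> dist x0 (fst y) + dist (fst y) (fst y + axis i (circlepath 0 r (snd y)))"
      by (rule dist_triangle)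
    also have "\<dots> \<le> r + r"
      using that norm_circlepath[OF r] by (intro add_mono) (auto simp: dist_norm norm_axis norm_minus_commute)
    finally show "fst y + axis i (circlepath 0 r (snd y)) \<in> cball x0 (2*r)" by simp
  qed
  then show ?thesis
    unfolding case_prod_beta using circlepath_ne[OF r]
    by (intro continuous_intros ci continuous_on_compose2[OF assms(1) sh]) auto
qed

text \<open>One radius serves all points of the ball, so Cauchy's formula becomes an identity of
  functions near \<open>x0\<close> and can itself be differentiated.\<close>

lemma pd_Cauchy_near:
  assumes F: "F \<in> hol U" and r: "r > 0" and sub: "cball x0 (2*r) \<subseteq> U" and x: "x \<in> ball x0 r"
  shows "pd i F x = integral (cbox 0 1) (\<lambda>t. F (x + axis i (circlepath 0 r t)) / circlepath 0 r t)"
proof -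
  have "dist x0 y \<le> 2 * r" if "dist x y \<le> r" for y
    using x that dist_triangle[of x0 y x] by simp
  then have "cball x r \<subseteq> U"
    using sub by auto
  then show ?thesis using pd_Cauchy[OF F r] by simp
qed

lemma obtain_double_ball:
  fixes x0 :: "'a::metric_space"
  assumes "open U" "x0 \<in> U"
  obtains r where "r > 0" "cball x0 (2*r) \<subseteq> U"
proof -
  obtain e where "e > 0" "cball x0 e \<subseteq> U" using assms open_contains_cball by blast
  then show ?thesis using that[of "e/2"] by simp
qed

text \<open>Needed before any second derivative: the Leibniz rule requires the derivative of the
  integrand to be jointly continuous.\<close>

lemma continuous_on_pd:
  assumes "open U" "F \<in> hol U"
  shows "continuous_on U (pd i F)"
proof (rule continuous_at_imp_continuous_on, rule ballI)
  fix x0 assume "x0 \<in> U"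
  then obtain r where r: "r > 0" "cball x0 (2*r) \<subseteq> U"
    using obtain_double_ball assms(1) by blast
  have "continuous_on (ball x0 r) (\<lambda>x. integral (cbox 0 1)
      (\<lambda>t. F (x + axis i (circlepath 0 r t)) / circlepath 0 r t))"
    by (intro integral_continuous_on_param continuous_on_shifted_circle[OF hol_imp_continuous_on[OF assms(2)] r])
  then have "continuous_on (ball x0 r) (pd i F)"
    by (rule continuous_on_eq) (rule pd_Cauchy_near[OF assms(2) r, symmetric])
  then show "isCont (pd i F) x0"
    using r by (simp add: continuous_on_eq_continuous_at)
qed

text \<open>Leibniz rule applied to Cauchy's formula. In the second claim the outer derivative
  \<open>pd j\<close> has moved inside the integral, while the circle still runs in direction i;
  this asymmetry is what yields the symmetry of second derivatives.\<close>

lemma pd_pd_Cauchy: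
  fixes F :: "complex^'n \<Rightarrow> complex"
  assumes "open U" "F \<in> hol U" and r: "r > 0" "cball x0 (2*r) \<subseteq> U"
  shows "cdiff_at (pd i F) x0"
    and "pd j (pd i F) x0 =
      integral (cbox 0 1) (\<lambda>t. pd j F (x0 + axis i (circlepath 0 r t)) / circlepath 0 r t)"
proof -
  define c where "c = circlepath 0 r"
  \<comment> \<open>Derivative in x of the integrand, in gradient form. It is packed as a
    \<open>Blinfun\<close> because the Leibniz rule integrates an operator-valued function.\<close>
  define L where "L x t = Blinfun (\<lambda>v. \<Sum>j\<in>UNIV. v$j * (pd j F (x + axis i (c t)) / c t))"
    for x :: "complex^'n" and t :: real
  have L: "blinfun_apply (L x t) = (\<lambda>v. \<Sum>j\<in>UNIV. v$j * (pd j F (x + axis i (c t)) / c t))" for x t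
    unfolding L_def by (intro bounded_linear_Blinfun_apply bounded_linear_sum
        bounded_linear_mult_const bounded_linear_vec_nth)
  have inU: "x + axis i (c t) \<in> U" if "x \<in> ball x0 r" for x t
  proof (rule subsetD[OF r(2)])
    have "dist x0 (x + axis i (c t)) \<le> dist x0 x + dist x (x + axis i (c t))"
      by (rule dist_triangle)
    also have "\<dots> \<le> r + r"
      using that norm_circlepath[OF r(1)] by (intro add_mono) (auto simp: c_def dist_norm norm_axis)
    finally show "x + axis i (c t) \<in> cball x0 (2*r)" by simp
  qed
  have D: "((\<lambda>x. F (x + axis i (c t)) / c t) has_derivative blinfun_apply (L x t)) (at x within ball x0 r)"
    if "x \<in> ball x0 r" for x t
  proof -
    have "cdiff_at F (x + axis i (c t))"
      using inU[OF that] assms(2) by (simp add: hol_iff_cdiff_at)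
    moreover have "((\<lambda>x. x + axis i (c t)) has_derivative (\<lambda>v. v)) (at x within ball x0 r)"
      by (auto intro!: derivative_eq_intros)
    ultimately have "((\<lambda>x. F (x + axis i (c t))) has_derivative
       (\<lambda>v. \<Sum>j\<in>UNIV. v$j * pd j F (x + axis i (c t)))) (at x within ball x0 r)"
      using has_derivative_compose[where f="\<lambda>x. x + axis i (c t)" and f'="\<lambda>v. v" and g=F]
        cdiff_at_has_derivative by blast
    from has_derivative_mult_left[OF this, of "1 / c t"] show ?thesis
      by (simp add: L sum_divide_distrib)
  qed
  have contL: "continuous_on (ball x0 r \<times> cbox 0 1) (\<lambda>(x,t). L x t)"
    unfolding case_prod_beta
  \<comment> \<open>In finite dimension continuity of an operator-valued function can be tested on
    vectors, where it is continuity of the partial derivatives.\<close>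
  proof (rule continuous_on_blinfun_componentwise)
    fix b :: "complex^'n"
    show "continuous_on (ball x0 r \<times> cbox 0 1) (\<lambda>y. blinfun_apply (L (fst y) (snd y)) b)"
      unfolding L c_def
      using continuous_on_shifted_circle[OF continuous_on_pd[OF assms(1,2)] r, unfolded case_prod_beta]
      by (intro continuous_on_sum continuous_on_mult continuous_on_const)
  qed
  have contF: "continuous_on (ball x0 r \<times> cbox 0 1) (\<lambda>(x,t). F (x + axis i (c t)) / c t)"
    unfolding c_def by (intro continuous_on_shifted_circle[OF hol_imp_continuous_on[OF assms(2)] r])
  have int: "(\<lambda>t. g x t) integrable_on cbox 0 1"
    if "continuous_on (ball x0 r \<times> cbox (0::real) 1) (\<lambda>(x,t). g x t)" "x \<in> ball x0 r"
    for g :: "complex^'n \<Rightarrow> real \<Rightarrow> 'b::banach" and x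
  proof -
    have "continuous_on (cbox 0 1) (\<lambda>t::real. (x, t))" by (intro continuous_intros)
    from continuous_on_compose2[OF that(1) this] show ?thesis
      using that(2) by (intro integrable_continuous) (simp add: image_subset_iff)
  qed
  have x0: "x0 \<in> ball x0 r" using r by simp
  have "((\<lambda>x. integral (cbox 0 1) (\<lambda>t. F (x + axis i (c t)) / c t)) has_derivative
      blinfun_apply (integral (cbox 0 1) (L x0))) (at x0 within ball x0 r)"
    using D contL int[OF contF] x0 by (intro leibniz_rule) auto
  then have "((\<lambda>x. integral (cbox 0 1) (\<lambda>t. F (x + axis i (c t)) / c t)) has_derivative
      blinfun_apply (integral (cbox 0 1) (L x0))) (at x0)"
    using x0 at_within_open[OF x0 open_ball] by simp
  then have "(pd i F has_derivative blinfun_apply (integral (cbox 0 1) (L x0))) (at x0)"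
    by (rule has_derivative_transform_within_open[OF _ open_ball x0])
      (simp add: pd_Cauchy_near[OF assms(2) r] c_def)
  moreover have "blinfun_apply (integral (cbox 0 1) (L x0)) =
      (\<lambda>v. \<Sum>j\<in>UNIV. v$j * integral (cbox 0 1) (\<lambda>t. pd j F (x0 + axis i (c t)) / c t))"
  proof
    fix v
    have i: "(\<lambda>t. pd j F (x0 + axis i (c t)) / c t) integrable_on cbox 0 1" for j
      using int[OF continuous_on_shifted_circle[OF continuous_on_pd[OF assms(1,2)] r] x0] by (simp add: c_def)
    have "blinfun_apply (integral (cbox 0 1) (L x0)) v = integral (cbox 0 1) (\<lambda>t. L x0 t v)"
      by (rule blinfun_apply_integral[OF int[OF contL x0]])
    also have "\<dots> = (\<Sum>j\<in>UNIV. integral (cbox 0 1) (\<lambda>t. v$j * (pd j F (x0 + axis i (c t)) / c t)))"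
      unfolding L by (rule integral_sum) (auto intro!: integrable_on_mult_right i[simplified] simp del: times_divide_eq_right)
    finally show "blinfun_apply (integral (cbox 0 1) (L x0)) v =
        (\<Sum>j\<in>UNIV. v$j * integral (cbox 0 1) (\<lambda>t. pd j F (x0 + axis i (c t)) / c t))"
      by (simp only: integral_mult_right)
  qed
  ultimately have "(pd i F has_derivative
      (\<lambda>v. \<Sum>j\<in>UNIV. v$j * integral (cbox 0 1) (\<lambda>t. pd j F (x0 + axis i (c t)) / c t))) (at x0)"
    by simp
  from cdiff_at_gradientI[OF this] show "cdiff_at (pd i F) x0"
    "pd j (pd i F) x0 =
      integral (cbox 0 1) (\<lambda>t. pd j F (x0 + axis i (circlepath 0 r t)) / circlepath 0 r t)"
    by (simp_all add: c_def)
qed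

lemma hol_pd: "open U \<Longrightarrow> F \<in> hol U \<Longrightarrow> pd i F \<in> hol U"
proof (unfold hol_iff_cdiff_at[of "pd i F"], rule ballI)
  fix x assume U: "open U" "F \<in> hol U" "x \<in> U"
  then obtain r where "r > 0" "cball x (2*r) \<subseteq> U"
    using obtain_double_ball by blast
  then show "cdiff_at (pd i F) x" using pd_pd_Cauchy(1) U by blast
qed

text \<open>One integral, of \<open>pd j F\<close> over the circle in direction i, has both values:
  by Cauchy's formula for the holomorphic function \<open>pd j F\<close>, and by differentiating
  Cauchy's formula for \<open>pd i F\<close>.\<close>

lemma pd_commute:
  assumes "open U" "F \<in> hol U" "x \<in> U"
  shows "pd i (pd j F) x = pd j (pd i F) x"
proof -
  obtain r where r: "r > 0" "cball x (2*r) \<subseteq> U"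
    using obtain_double_ball assms by blast
  then have "x \<in> ball x r" by simp
  then show ?thesis
    by (rule trans[OF pd_Cauchy_near[OF hol_pd[OF assms(1,2)] r] pd_pd_Cauchy(2)[OF assms(1,2) r, symmetric]])
qed


section \<open>Calculus rules for partial derivatives\<close>

lemma cdiff_at_has_field_derivative_compose:
  assumes G: "cdiff_at G x" and f: "(f has_field_derivative d) (at (G x))"
  shows "cdiff_at (\<lambda>v. f (G v)) x" "pd i (\<lambda>v. f (G v)) x = d * pd i G x"
proof -
  have "((\<lambda>v. f (G v)) has_derivative (\<lambda>v. d * (\<Sum>j\<in>UNIV. v$j * pd j G x))) (at x)"
    by (rule has_derivative_compose[OF cdiff_at_has_derivative[OF G] f[unfolded has_field_derivative_def]])
  then have "((\<lambda>v. f (G v)) has_derivative (\<lambda>v. \<Sum>j\<in>UNIV. v$j * (d * pd j G x))) (at x)"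
    by (simp add: sum_distrib_left mult.left_commute)
  from cdiff_at_gradientI[OF this] show "cdiff_at (\<lambda>v. f (G v)) x" "pd i (\<lambda>v. f (G v)) x = d * pd i G x"
    by auto
qed

lemma cdiff_at_const [simp]: "cdiff_at (\<lambda>_. c) x"
  and pd_const [simp]: "pd i (\<lambda>_. c) x = 0"
  using cdiff_at_gradientI[of "\<lambda>_. c" "\<lambda>_. 0" x] by auto

lemma
  fixes x :: "complex^'n"
  shows cdiff_at_nth [simp]: "cdiff_at (\<lambda>v. v$k) x"
  and pd_nth [simp]: "pd i (\<lambda>v. v$k) x = (if i = k then 1 else 0)"
proof -
  have "(\<Sum>j\<in>UNIV. v$j * (if j = k then 1 else 0)) = v$k" for v :: "complex^'n"
    by (simp add: if_distrib[of "\<lambda>y. _ * y"] cong: if_cong)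
  then have "((\<lambda>v. v$k) has_derivative (\<lambda>v. \<Sum>j\<in>UNIV. v$j * (if j = k then 1 else 0))) (at x)"
    by (simp only: bounded_linear_imp_has_derivative[OF bounded_linear_vec_nth])
  from cdiff_at_gradientI[OF this] show "cdiff_at (\<lambda>v. v$k) x" "pd i (\<lambda>v. v$k) x = (if i = k then 1 else 0)"
    by auto
qed

context
  fixes F G :: "complex^'n \<Rightarrow> complex" and x :: "complex^'n"
  assumes F: "cdiff_at F x" and G: "cdiff_at G x"
begin

lemma cdiff_at_add [simp]: "cdiff_at (\<lambda>v. F v + G v) x"
  and pd_add [simp]: "pd i (\<lambda>v. F v + G v) x = pd i F x + pd i G x"
proof -
  have "((\<lambda>v. F v + G v) has_derivative (\<lambda>v. \<Sum>j\<in>UNIV. v$j * (pd j F x + pd j G x))) (at x)"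
    using has_derivative_add[OF F[THEN cdiff_at_has_derivative] G[THEN cdiff_at_has_derivative]]
    by (simp add: sum.distrib distrib_left)
  from cdiff_at_gradientI[OF this]
  show "cdiff_at (\<lambda>v. F v + G v) x" "pd i (\<lambda>v. F v + G v) x = pd i F x + pd i G x" by auto
qed

lemma cdiff_at_mult [simp]: "cdiff_at (\<lambda>v. F v * G v) x"
  and pd_mult [simp]: "pd i (\<lambda>v. F v * G v) x = pd i F x * G x + F x * pd i G x"
proof -
  have "((\<lambda>v. F v * G v) has_derivative (\<lambda>v. \<Sum>j\<in>UNIV. v$j * (pd j F x * G x + F x * pd j G x))) (at x)"
    using has_derivative_mult[OF F[THEN cdiff_at_has_derivative] G[THEN cdiff_at_has_derivative]]
    by (simp add: sum.distrib distrib_left sum_distrib_left sum_distrib_right mult_ac add.commute)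
  from cdiff_at_gradientI[OF this]
  show "cdiff_at (\<lambda>v. F v * G v) x" "pd i (\<lambda>v. F v * G v) x = pd i F x * G x + F x * pd i G x" by auto
qed

end

lemma cdiff_at_uminus [simp]: "cdiff_at F x \<Longrightarrow> cdiff_at (\<lambda>v. - F v) x"
  and pd_uminus [simp]: "cdiff_at F x \<Longrightarrow> pd i (\<lambda>v. - F v) x = - pd i F x"
  using cdiff_at_mult[of "\<lambda>_. -1" x F] pd_mult[of "\<lambda>_. -1" x F i] by simp_all

lemma cdiff_at_diff [simp]: "cdiff_at F x \<Longrightarrow> cdiff_at G x \<Longrightarrow> cdiff_at (\<lambda>v. F v - G v) x"
  and pd_diff [simp]:
    "cdiff_at F x \<Longrightarrow> cdiff_at G x \<Longrightarrow> pd i (\<lambda>v. F v - G v) x = pd i F x - pd i G x"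
  using cdiff_at_add[of F x "\<lambda>v. - G v"] pd_add[of F x "\<lambda>v. - G v" i] by simp_all

lemma cdiff_at_poly [simp]: "cdiff_at G x \<Longrightarrow> cdiff_at (\<lambda>v. poly q (G v)) x"
  and pd_poly [simp]: "cdiff_at G x \<Longrightarrow> pd i (\<lambda>v. poly q (G v)) x = poly (pderiv q) (G x) * pd i G x"
  using cdiff_at_has_field_derivative_compose[OF _ poly_DERIV] by blast+

lemma cdiff_at_divide [simp]:
    "cdiff_at F x \<Longrightarrow> cdiff_at G x \<Longrightarrow> G x \<noteq> 0 \<Longrightarrow> cdiff_at (\<lambda>v. F v / G v) x"
  and pd_divide [simp]: "cdiff_at F x \<Longrightarrow> cdiff_at G x \<Longrightarrow> G x \<noteq> 0 \<Longrightarrow>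
    pd i (\<lambda>v. F v / G v) x = pd i F x / G x - F x * pd i G x / (G x)^2"
proof -
  assume F: "cdiff_at F x" and G: "cdiff_at G x" and ne: "G x \<noteq> 0"
  have "(inverse has_field_derivative - (inverse (G x) ^ Suc (Suc 0))) (at (G x))"
    by (rule DERIV_inverse[OF ne])
  note I = cdiff_at_has_field_derivative_compose[OF G this]
  show "cdiff_at (\<lambda>v. F v / G v) x"
    unfolding divide_inverse by (intro cdiff_at_mult F I)
  show "pd i (\<lambda>v. F v / G v) x = pd i F x / G x - F x * pd i G x / (G x)^2"
    unfolding divide_inverse pd_mult[OF F I(1)] I(2) by (simp add: power2_eq_square)
qed

text \<open>Locality of partial derivatives, used wherever two functions are known to agree only on
  an open set.\<close>

lemma cdiff_at_cong_open:
  assumes "open S" "x \<in> S" "\<And>y. y \<in> S \<Longrightarrow> F y = G y" "cdiff_at F x"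
  shows "cdiff_at G x" "pd i G x = pd i F x"
proof -
  have "(G has_derivative (\<lambda>v. \<Sum>j\<in>UNIV. v$j * pd j F x)) (at x)"
    by (rule has_derivative_transform_within_open[OF cdiff_at_has_derivative]) (use assms in auto)
  from cdiff_at_gradientI[OF this] show "cdiff_at G x" "pd i G x = pd i F x" by auto
qed

lemma cdiff_at_chain:
  fixes \<phi> :: "complex^'m \<Rightarrow> complex^'n"
  assumes \<phi>: "\<And>k. cdiff_at (\<lambda>u. \<phi> u $ k) u" and F: "cdiff_at F (\<phi> u)"
  shows "cdiff_at (\<lambda>u. F (\<phi> u)) u"
    "pd i (\<lambda>u. F (\<phi> u)) u = (\<Sum>k\<in>UNIV. pd i (\<lambda>u. \<phi> u $ k) u * pd k F (\<phi> u))"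
proof -
  define L where "L v = (\<Sum>k\<in>UNIV. axis k (\<Sum>j\<in>UNIV. v$j * pd j (\<lambda>u. \<phi> u $ k) u))" for v :: "complex^'m"
  \<comment> \<open>Writing \<phi> as the sum of its coordinates along the axes lets the
    componentwise derivatives be added up to a derivative of \<phi>.\<close>
  have expand: "(\<Sum>k\<in>UNIV. axis k (w$k)) = w" for w :: "complex^'n"
    by (simp add: vec_eq_iff axis_def if_distrib cong: if_cong)
  have "((\<lambda>u. \<Sum>k\<in>UNIV. axis k (\<phi> u $ k)) has_derivative L) (at u)"
    unfolding L_def
    by (intro has_derivative_sum bounded_linear.has_derivative[OF bounded_linear_axis]
        cdiff_at_has_derivative \<phi>)
  then have "(\<phi> has_derivative L) (at u)" by (simp only: expand)
  from has_derivative_compose[OF this cdiff_at_has_derivative[OF F]]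
  have "((\<lambda>u. F (\<phi> u)) has_derivative (\<lambda>v. \<Sum>k\<in>UNIV. L v $ k * pd k F (\<phi> u))) (at u)" .
  moreover have "L v $ k = (\<Sum>j\<in>UNIV. v$j * pd j (\<lambda>u. \<phi> u $ k) u)" for v k
    by (simp add: L_def axis_def cong: if_cong)
  then have "(\<Sum>k\<in>UNIV. L v $ k * pd k F (\<phi> u)) =
      (\<Sum>j\<in>UNIV. v$j * (\<Sum>k\<in>UNIV. pd j (\<lambda>u. \<phi> u $ k) u * pd k F (\<phi> u)))" for v
    by (simp add: sum_distrib_left sum_distrib_right mult.assoc) (rule sum.swap)
  ultimately have "((\<lambda>u. F (\<phi> u)) has_derivative
      (\<lambda>v. \<Sum>j\<in>UNIV. v$j * (\<Sum>k\<in>UNIV. pd j (\<lambda>u. \<phi> u $ k) u * pd k F (\<phi> u)))) (at u)"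
    by (simp only:)
  from cdiff_at_gradientI[OF this] show "cdiff_at (\<lambda>u. F (\<phi> u)) u"
    "pd i (\<lambda>u. F (\<phi> u)) u = (\<Sum>k\<in>UNIV. pd i (\<lambda>u. \<phi> u $ k) u * pd k F (\<phi> u))"
    by auto
qed

lemma hol_cdiff_at: "F \<in> hol U \<Longrightarrow> x \<in> U \<Longrightarrow> cdiff_at F x"
  by (simp add: hol_iff_cdiff_at)

lemma hol_subset: "F \<in> hol U \<Longrightarrow> V \<subseteq> U \<Longrightarrow> F \<in> hol V"
  by (auto simp: hol_iff_cdiff_at)

lemma hol_linear_combination: "F \<in> hol U \<Longrightarrow> G \<in> hol U \<Longrightarrow> (\<lambda>y. a * F y + b * G y) \<in> hol U"
  by (simp add: hol_iff_cdiff_at)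

section \<open>Representations\<close>

text \<open>By bilinearity the bracket identity for all X and Y comes down to the three relations
  between generators; the central element acts as a scalar.\<close>

lemma m_representationI:
  assumes lincomb: "\<And>F G a b. F \<in> V \<Longrightarrow> G \<in> V \<Longrightarrow> (\<lambda>y. a * F y + b * G y) \<in> V"
    and closed: "\<And>D F. D \<in> {N, P, M} \<Longrightarrow> F \<in> V \<Longrightarrow> D F \<in> V"
    and cong: "\<And>D F G x. D \<in> {N, P, M} \<Longrightarrow> F \<in> V \<Longrightarrow> G \<in> V \<Longrightarrow> (\<forall>x\<in>S. F x = G x) \<Longrightarrow> x \<in> S \<Longrightarrow>
      D F x = D G x"
    and linear: "\<And>D F G a b x. D \<in> {N, P, M} \<Longrightarrow> F \<in> V \<Longrightarrow> G \<in> V \<Longrightarrow> x \<in> S \<Longrightarrow>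
      D (\<lambda>y. a * F y + b * G y) x = a * D F x + b * D G x"
    and comm: "\<And>F x. F \<in> V \<Longrightarrow> x \<in> S \<Longrightarrow> commutator N P F x = P F x"
      "\<And>F x. F \<in> V \<Longrightarrow> x \<in> S \<Longrightarrow> commutator N M F x = - M F x"
      "\<And>F x. F \<in> V \<Longrightarrow> x \<in> S \<Longrightarrow> commutator P M F x = 2 * \<alpha> * N F x + \<beta> * F x"
  shows "m_representation \<alpha> \<beta> S V (m_action N P M)"
proof -
  have lincomb4: "(\<lambda>y. a * F1 y + b * F2 y + c * F3 y + d * F4 y) \<in> V"
    if "F1 \<in> V" "F2 \<in> V" "F3 \<in> V" "F4 \<in> V" for F1 F2 F3 F4 a b c d
    using lincomb[OF lincomb[OF that(1,2), of a b] lincomb[OF that(3,4), of c d], of 1 1]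
    by (simp add: add.assoc)
  have linear4: "D (\<lambda>y. a * F1 y + b * F2 y + c * F3 y + d * F4 y) x =
      a * D F1 x + b * D F2 x + c * D F3 x + d * D F4 x"
    if "D \<in> {N, P, M}" "x \<in> S" "F1 \<in> V" "F2 \<in> V" "F3 \<in> V" "F4 \<in> V" for D x F1 F2 F3 F4 a b c d
    using linear[OF that(1) lincomb[OF that(3,4), of a b] lincomb[OF that(5,6), of c d] that(2), of 1 1]
      linear[OF that(1,3,4,2), of a b] linear[OF that(1,5,6,2), of c d]
    by (simp add: add.assoc)
  have NPM: "N F \<in> V" "P F \<in> V" "M F \<in> V" if "F \<in> V" for F
    using closed that by auto
  have expand: "D (m_action N P M Y F) x = Y$1 * D (N F) x + Y$2 * D (P F) x + Y$3 * D (M F) x + Y$4 * D F x"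
    if "D \<in> {N, P, M}" "x \<in> S" "F \<in> V" for D Y F x
    using linear4[OF that(1,2) NPM[OF that(3)] that(3)] unfolding m_action_def[abs_def] .
  show ?thesis
    unfolding m_representation_def
  proof (intro conjI allI ballI impI)
    fix X F assume "F \<in> V"
    then show "m_action N P M X F \<in> V"
      unfolding m_action_def[abs_def] by (intro lincomb4 NPM)
  next
    fix X F G x assume "F \<in> V" "G \<in> V" "\<forall>x\<in>S. F x = G x" "x \<in> S"
    then show "m_action N P M X F x = m_action N P M X G x"
      unfolding m_action_def using cong[of N F G x] cong[of P F G x] cong[of M F G x] by simp
  next
    fix X a b F G x assume "F \<in> V" "G \<in> V" "x \<in> S"
    then show "m_action N P M X (\<lambda>y. a * F y + b * G y) x = a * m_action N P M X F x + b * m_action N P M X G x"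
      unfolding m_action_def using linear[of N F G x a b] linear[of P F G x a b] linear[of M F G x a b]
      by (simp add: algebra_simps)
  next
    fix X Y a b F x assume "F \<in> V" "x \<in> S"
    then show "m_action N P M (a *s X + b *s Y) F x = a * m_action N P M X F x + b * m_action N P M Y F x"
      unfolding m_action_def by (simp add: algebra_simps)
  next
    fix X Y F x assume F: "F \<in> V" "x \<in> S"
    \<comment> \<open>Normal ordering: every product of two generators is rewritten with N before P
      before M. Both sides of the bracket identity then become combinations of the same
      terms.\<close>
    have "P (N F) x = N (P F) x - P F x" "M (N F) x = N (M F) x + M F x"
      "M (P F) x = P (M F) x - 2 * \<alpha> * N F x - \<beta> * F x"
      using comm[OF F] by (simp_all add: commutator_def algebra_simps)
    then show "m_action N P M (m_bracket \<alpha> \<beta> X Y) F x = commutator (m_action N P M X) (m_action N P M Y) F x"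
      \<comment> \<open>Only the outer actions are unfolded; the inner ones must stay whole so that
        \<open>expand\<close> can move an operator through them.\<close>
      unfolding commutator_def m_action_def[of N P M X "m_action N P M Y F"]
        m_action_def[of N P M Y "m_action N P M X F"]
      by (simp add: expand F m_bracket_def)
        (simp add: m_action_def algebra_simps)
  next
    fix F x assume "F \<in> V" "x \<in> S"
    then show "m_action N P M (axis 4 1) F x = F x" by (simp add: m_action_def axis_def)
  qed
qed

section \<open>The operators on three-dimensional space\<close>

lemma ops3_apply:
  "N_op F = (\<lambda>v. v$1 * pd 1 F v - v$2 * pd 2 F v)"
  "Ap_op \<sigma> F = (\<lambda>v. v$1 * pd 3 F v + deriv_poly \<sigma> (v$3) * pd 2 F v)"
  "Am_op \<sigma> \<kappa> F = (\<lambda>v. v$2 * pd 3 F v + deriv_poly \<sigma> (v$3) * pd 1 F v + poly \<kappa> (v$3) / v$1 * F v)"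
  by (auto simp: N_op_def Ap_op_def Am_op_def)

lemma ops3_hol:
  assumes "open U" "U \<subseteq> t_nonzero" "D \<in> {N_op, Ap_op \<sigma>, Am_op \<sigma> \<kappa>}" "F \<in> hol U"
  shows "D F \<in> hol U"
proof -
  have "cdiff_at (D F) v" if "v \<in> U" for v
  proof -
    have "v$1 \<noteq> 0" using that assms(2) by (auto simp: t_nonzero_def)
    moreover have "cdiff_at F v" "cdiff_at (pd i F) v" for i
      using hol_cdiff_at that assms hol_pd by blast+
    ultimately show ?thesis using assms(3) by (auto simp: ops3_apply)
  qed
  then show ?thesis by (simp add: hol_iff_cdiff_at)
qed

text \<open>The second-order terms cancel because partial derivatives commute. In [A+, A-] the two
  terms with \<sigma>' times the z-derivative cancel as well, which leaves \<sigma>'' N and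
  \<kappa>'. The degree bounds make these coefficients constant.\<close>

lemma ops3_commutators:
  assumes U: "open U" "U \<subseteq> t_nonzero" and F: "F \<in> hol U" and v: "v \<in> U"
    and deg: "degree \<sigma> \<le> 2" "degree \<kappa> \<le> 1"
  shows "commutator N_op (Ap_op \<sigma>) F v = Ap_op \<sigma> F v"
    "commutator N_op (Am_op \<sigma> \<kappa>) F v = - Am_op \<sigma> \<kappa> F v"
    "commutator (Ap_op \<sigma>) (Am_op \<sigma> \<kappa>) F v = const_deriv2 \<sigma> * N_op F v + const_deriv \<kappa> * F v"
proof -
  have v1: "v$1 \<noteq> 0" using v U by (auto simp: t_nonzero_def)
  have cd: "cdiff_at F v" "cdiff_at (pd i F) v" for i
    using hol_cdiff_at F v U hol_pd by blast+
  have comm: "pd 2 (pd 1 F) v = pd 1 (pd 2 F) v" "pd 3 (pd 1 F) v = pd 1 (pd 3 F) v"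
     "pd 3 (pd 2 F) v = pd 2 (pd 3 F) v"
    using pd_commute[OF U(1) F v] by auto
  note d = pderiv2_eq_const_deriv2[OF deg(1)] pderiv_eq_const_deriv[OF deg(2)]
  show "commutator N_op (Ap_op \<sigma>) F v = Ap_op \<sigma> F v"
    using v1 cd comm d by (simp add: commutator_def ops3_apply algebra_simps)
  show "commutator N_op (Am_op \<sigma> \<kappa>) F v = - Am_op \<sigma> \<kappa> F v"
    using v1 cd comm d by (simp add: commutator_def ops3_apply) (simp add: field_simps power2_eq_square)
  show "commutator (Ap_op \<sigma>) (Am_op \<sigma> \<kappa>) F v = const_deriv2 \<sigma> * N_op F v + const_deriv \<kappa> * F v"
    using v1 cd comm d by (simp add: commutator_def ops3_apply) (simp add: field_simps power2_eq_square)
qed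

text \<open>The first-order parts annihilate \<sigma>(z) - ts: N gives -ts + st, A+ gives t\<sigma>'
  - \<sigma>'t, and A- gives s\<sigma>' - \<sigma>'s. The remaining term of A- is a
  multiplication.\<close>

lemma ops3_commute_quadric:
  assumes "v$1 \<noteq> 0" "D \<in> {N_op, Ap_op \<sigma>, Am_op \<sigma> \<kappa>}" "cdiff_at F v"
  shows "D (\<lambda>y. quadric \<sigma> y * F y) v = quadric \<sigma> v * D F v"
  using assms by (auto simp: ops3_apply quadric_def algebra_simps)

lemma ops3_linear:
  assumes "D \<in> {N_op, Ap_op \<sigma>, Am_op \<sigma> \<kappa>}" "cdiff_at F v" "cdiff_at G v"
  shows "D (\<lambda>y. a * F y + b * G y) v = a * D F v + b * D G v"
  using assms by (auto simp: ops3_apply algebra_simps add_divide_distrib)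

lemma ops3_representation:
  assumes U: "open U" "U \<subseteq> t_nonzero" and deg: "degree \<sigma> \<le> 2" "degree \<kappa> \<le> 1"
  shows "m_representation (const_deriv2 \<sigma> / 2) (const_deriv \<kappa>) U (hol U)
          (m_action N_op (Ap_op \<sigma>) (Am_op \<sigma> \<kappa>))"
proof (rule m_representationI)
  fix D F G x
  assume "D \<in> {N_op, Ap_op \<sigma>, Am_op \<sigma> \<kappa>}" "F \<in> hol U" "G \<in> hol U" "\<forall>x\<in>U. F x = G x" "x \<in> U"
  moreover from this have "pd i G x = pd i F x" for i
    using cdiff_at_cong_open(2)[OF U(1), of x F G] hol_cdiff_at by blast
  ultimately show "D F x = D G x" by (auto simp: ops3_apply)
qed (use ops3_commutators[OF U _ _ deg] ops3_linear hol_cdiff_at ops3_hol[OF U] hol_linear_combination in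
    \<open>auto simp: hol_cdiff_at\<close>)


section \<open>The coordinates \<open>(w, z)\<close> on the quadric\<close>

definition quadric_point :: "complex poly \<Rightarrow> complex^2 \<Rightarrow> complex^3" where
  "quadric_point \<sigma> u = vector [u$1, poly \<sigma> (u$2) / u$1, u$2]"

lemma quadric_point_nth [simp]:
  "quadric_point \<sigma> u $ 1 = u$1" "quadric_point \<sigma> u $ 2 = poly \<sigma> (u$2) / u$1" "quadric_point \<sigma> u $ 3 = u$2"
  by (simp_all add: quadric_point_def)

definition tz :: "complex^3 \<Rightarrow> complex^2" where
  "tz v = vector [v$1, v$3]"

lemma tz_nth [simp]: "tz v $ 1 = v$1" "tz v $ 2 = v$3"
  by (simp_all add: tz_def)

lemma wz_eq_tz: "wz p = tz \<circ> p"
  by (auto simp: wz_def tz_def)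

text \<open>In the coordinates (t, z) the condition that s is nonzero reads as \<sigma>(z) being
  nonzero.\<close>

definition coord_domain :: "complex poly \<Rightarrow> (complex^2) set" where
  "coord_domain \<sigma> = {u. u$1 \<noteq> 0 \<and> poly \<sigma> (u$2) \<noteq> 0}"

lemma continuous_on_vec_components:
  fixes f :: "'a::topological_space \<Rightarrow> complex^'n"
  assumes "\<And>k. continuous_on S (\<lambda>x. f x $ k)"
  shows "continuous_on S f"
  using continuous_on_vec_lambda[where f="\<lambda>k x. f x $ k", OF assms] by simp

lemma continuous_on_tz: "continuous_on S tz"
proof (rule continuous_on_vec_components)
  fix k :: 2
  have "continuous_on S (\<lambda>v. v$1)" "continuous_on S (\<lambda>v. v$3)" for S :: "(complex^3) set"
    by (intro continuous_intros)+
  then show "continuous_on S (\<lambda>v. tz v $ k)"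
    using exhaust_2[of k] by auto
qed

lemma continuous_on_quadric_point: "continuous_on (coord_domain \<sigma>) (quadric_point \<sigma>)"
proof (rule continuous_on_vec_components)
  fix k :: 3
  have "continuous_on (coord_domain \<sigma>) (\<lambda>v. v$1)" "continuous_on (coord_domain \<sigma>) (\<lambda>v. v$2)"
    by (intro continuous_intros)+
  moreover from this have "continuous_on (coord_domain \<sigma>) (\<lambda>v. poly \<sigma> (v$2) / v$1)"
    by (intro continuous_intros) (auto simp: coord_domain_def)
  ultimately show "continuous_on (coord_domain \<sigma>) (\<lambda>v. quadric_point \<sigma> v $ k)"
    using exhaust_3[of k] by auto
qed

lemma open_coord_domain: "open (coord_domain \<sigma>)"
proof -
  have "coord_domain \<sigma> = {u. u$1 * poly \<sigma> (u$2) \<noteq> 0}" by (auto simp: coord_domain_def)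
  moreover have "open {u :: complex^2. u$1 * poly \<sigma> (u$2) \<noteq> 0}"
    by (intro open_Collect_neq continuous_intros)
  ultimately show ?thesis by simp
qed

text \<open>On the quadric itself (t, z) is a global coordinate system. On \<Omega> it is only local
  because p need not be injective.\<close>

lemma homeomorphism_tz: "homeomorphism (quadric_manifold \<sigma>) (coord_domain \<sigma>) tz (quadric_point \<sigma>)"
  by (rule homeomorphismI[OF continuous_on_tz continuous_on_quadric_point])
    (auto simp: quadric_manifold_def coord_domain_def quadric_def vec_eq_iff forall_2 forall_3 field_simps)

lemma cdiff_at_quadric_point_nth: "u$1 \<noteq> 0 \<Longrightarrow> cdiff_at (\<lambda>u. quadric_point \<sigma> u $ k) u"
  using exhaust_3[of k] by auto

text \<open>Each operator is paired with its coordinate expression, so that the transfer between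
  them is proved once for all three.\<close>

definition op_pairs :: "complex poly \<Rightarrow> complex poly \<Rightarrow> ((complex^3) operator \<times> (complex^2) operator) set" where
  "op_pairs \<sigma> \<kappa> = {(N_op, N_wz), (Ap_op \<sigma>, Ap_wz), (Am_op \<sigma> \<kappa>, Am_wz \<sigma> \<kappa>)}"

text \<open>
  The operators are tangent to the quadric: at its points they only see the values of \<open>F\<close> on it.
\<close>

lemma op_quadric_point:
  assumes u: "u$1 \<noteq> 0" and F: "cdiff_at F (quadric_point \<sigma> u)" and D: "(D, D') \<in> op_pairs \<sigma> \<kappa>"
  shows "D F (quadric_point \<sigma> u) = D' (\<lambda>u. F (quadric_point \<sigma> u)) u"
proof -
  have "pd i (\<lambda>u. F (quadric_point \<sigma> u)) u =
      (\<Sum>k\<in>UNIV. pd i (\<lambda>u. quadric_point \<sigma> u $ k) u * pd k F (quadric_point \<sigma> u))" for i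
    by (rule cdiff_at_chain(2)[OF cdiff_at_quadric_point_nth[OF u] F])
  \<comment> \<open>On the graph s = \<sigma>(z)/w has derivatives -\<sigma>/w^2 in w and
    \<sigma>'/w in z. In A- the two resulting contributions of the s-derivative cancel.\<close>
  then have pd: "pd 1 (\<lambda>u. F (quadric_point \<sigma> u)) u =
      pd 1 F (quadric_point \<sigma> u) - poly \<sigma> (u$2) / (u$1)^2 * pd 2 F (quadric_point \<sigma> u)"
    "pd 2 (\<lambda>u. F (quadric_point \<sigma> u)) u =
      poly (pderiv \<sigma>) (u$2) / u$1 * pd 2 F (quadric_point \<sigma> u) + pd 3 F (quadric_point \<sigma> u)"
    using u by (simp_all add: sum_3)
  from D u show ?thesis
    by (auto simp: op_pairs_def ops3_apply N_wz_def Ap_wz_def Am_wz_def pd field_simps power2_eq_square)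
qed

lemma ops2_apply:
  "N_wz G = (\<lambda>u. u$1 * pd 1 G u)"
  "Ap_wz G = (\<lambda>u. u$1 * pd 2 G u)"
  "Am_wz \<sigma> \<kappa> G = (\<lambda>u. 1 / u$1 *
    (poly \<sigma> (u$2) * pd 2 G u + deriv_poly \<sigma> (u$2) * (u$1 * pd 1 G u) + poly \<kappa> (u$2) * G u))"
  by (auto simp: N_wz_def Ap_wz_def Am_wz_def)

lemma ops2_cong:
  assumes "open S" "u \<in> S" "\<And>y. y \<in> S \<Longrightarrow> F y = G y" "cdiff_at F u" "(D, D') \<in> op_pairs \<sigma> \<kappa>"
  shows "D' F u = D' G u"
  using cdiff_at_cong_open(2)[OF assms(1-4)] assms(2,3,5) by (auto simp: op_pairs_def ops2_apply)

text \<open>Behind the computation: A- A+ contributes the terms with \<sigma>, \<kappa> and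
  \<sigma>'(N + 1), and the symmetrized product exceeds it by half of [A+, A-], that is by
  (\<sigma>'' N + \<kappa>')/2. This turns N^2 into N(N + 1) and N into N + 1/2 in the last two
  terms.\<close>

lemma casimir_wz_eq:
  assumes W: "open W" "u \<in> W" "G \<in> hol W" and u: "u$1 \<noteq> 0"
    and deg: "degree \<sigma> \<le> 2" "degree \<kappa> \<le> 1"
  shows "casimir (const_deriv2 \<sigma> / 2) (const_deriv \<kappa>) N_wz Ap_wz (Am_wz \<sigma> \<kappa>) G u = casimir_wz \<sigma> \<kappa> G u"
proof -
  have cd: "cdiff_at G u" "cdiff_at (pd i G) u" for i
    using hol_cdiff_at hol_pd W by blast+
  have comm: "pd 2 (pd 1 G) u = pd 1 (pd 2 G) u"
    using pd_commute[OF W(1,3,2)] by auto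
  note d = pderiv2_eq_const_deriv2[OF deg(1)] pderiv_eq_const_deriv[OF deg(2)]
  show ?thesis
    using u cd comm d
    by (simp add: casimir_def casimir_wz_def ops2_apply) (simp add: field_simps power2_eq_square)
qed

lemma pd_function_of_z:
  assumes "(h has_field_derivative d) (at (u$2))"
  shows "cdiff_at (\<lambda>u :: complex^2. h (u$2)) u" "pd 1 (\<lambda>u :: complex^2. h (u$2)) u = 0"
    "pd 2 (\<lambda>u :: complex^2. h (u$2)) u = d"
  using cdiff_at_has_field_derivative_compose[OF cdiff_at_nth assms] by auto

text \<open>All terms with a w-derivative vanish, so N + 1 leaves \<sigma>'h' and N + 1/2 leaves
  h/2. The first derivatives must be known on all of \<open>W\<close> before they can be
  differentiated again at u.\<close>

lemma casimir_wz_function_of_z: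
  assumes W: "open W" "u \<in> W" and G: "\<And>y. y \<in> W \<Longrightarrow> G y = h (y$2)"
    and h: "h holomorphic_on Z" "open Z" and Z: "\<And>y. y \<in> W \<Longrightarrow> y$2 \<in> Z"
  shows "casimir_wz \<sigma> \<kappa> G u = H_op \<sigma> \<kappa> h (u$2)"
proof -
  have h1: "(h has_field_derivative deriv h (y$2)) (at (y$2))"
      "(deriv h has_field_derivative deriv (deriv h) (y$2)) (at (y$2))" if "y \<in> W" for y
    using that h Z holomorphic_derivI holomorphic_deriv by blast+
  have p1: "pd i G y = pd i (\<lambda>u. h (u$2)) y" if "y \<in> W" for y i
    using cdiff_at_cong_open(2)[of W y "\<lambda>u. h (u$2)" G] pd_function_of_z(1)[OF h1(1)] W G that by simp
  have p1': "pd 1 G y = 0" "pd 2 G y = deriv h (y$2)" if "y \<in> W" for y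
    using p1[OF that] pd_function_of_z[OF h1(1)[OF that]] by auto
  have p2: "pd i (pd 2 G) u = pd i (\<lambda>u. deriv h (u$2)) u" for i
    using cdiff_at_cong_open(2)[of W u "\<lambda>u. deriv h (u$2)" "pd 2 G"] pd_function_of_z(1)[OF h1(2)] W p1' by simp
  have p3: "pd 1 (\<lambda>v. v$1 * pd 1 G v + G v) u = pd 1 (\<lambda>u. h (u$2)) u"
    using cdiff_at_cong_open(2)[of W u "\<lambda>u. h (u$2)" "\<lambda>v. v$1 * pd 1 G v + G v"]
      pd_function_of_z(1)[OF h1(1)] W p1' G by simp
  show ?thesis
    using W(2) by (simp add: casimir_wz_def H_op_def p2 p3 p1' G pd_function_of_z[OF h1(1)] pd_function_of_z[OF h1(2)])
      (simp add: algebra_simps)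
qed

section \<open>Functions and operators on the covering space\<close>

lemma local_extensionD:
  assumes "local_extension \<Omega> p f U V F"
  shows "openin (top_of_set \<Omega>) U" "open V" "V \<subseteq> t_nonzero" "F \<in> hol V" "U \<subseteq> \<Omega>"
    "\<And>y. y \<in> U \<Longrightarrow> p y \<in> V" "\<And>y. y \<in> U \<Longrightarrow> f y = F (p y)"
  using assms openin_imp_subset by (fastforce simp: local_extension_def)+

text \<open>Gives two functions a common pair of domains, so that their extensions can be
  added.\<close>

lemma local_extension_inter:
  assumes "local_extension \<Omega> p f U V F" "local_extension \<Omega> p g U' V' G"
  shows "local_extension \<Omega> p f (U \<inter> U') (V \<inter> V') F" "local_extension \<Omega> p g (U \<inter> U') (V \<inter> V') G"
  using assms unfolding local_extension_def by (auto intro: hol_subset)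

lemma local_extension_linear_combination:
  assumes "local_extension \<Omega> p f U V F" "local_extension \<Omega> p g U V G"
  shows "local_extension \<Omega> p (\<lambda>y. a * f y + b * g y) U V (\<lambda>y. a * F y + b * G y)"
  using assms by (auto simp: local_extension_def intro: hol_linear_combination)

lemma local_extension_cong:
  "local_extension \<Omega> p f U V F \<Longrightarrow> (\<And>x. x \<in> \<Omega> \<Longrightarrow> f x = g x) \<Longrightarrow> local_extension \<Omega> p g U V F"
  unfolding local_extension_def using openin_imp_subset by (metis subsetD)

lemma hol_coverE:
  assumes "f \<in> hol_cover \<Omega> p" "x \<in> \<Omega>"
  obtains U V F where "x \<in> U" "local_extension \<Omega> p f U V F"
  using assms unfolding hol_cover_def by blast

lemma hol_cover_common_extension:
  assumes "f \<in> hol_cover \<Omega> p" "g \<in> hol_cover \<Omega> p" "x \<in> \<Omega>"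
  obtains U V F G where "x \<in> U" "local_extension \<Omega> p f U V F" "local_extension \<Omega> p g U V G"
  using local_extension_inter hol_coverE[OF assms(1,3)] hol_coverE[OF assms(2,3)] by (metis IntI)

lemma hol_cover_linear_combination:
  assumes "f \<in> hol_cover \<Omega> p" "g \<in> hol_cover \<Omega> p"
  shows "(\<lambda>y. a * f y + b * g y) \<in> hol_cover \<Omega> p"
  unfolding hol_cover_def
proof (intro CollectI ballI)
  fix x assume x: "x \<in> \<Omega>"
  obtain U V F G where "x \<in> U" "local_extension \<Omega> p f U V F" "local_extension \<Omega> p g U V G"
    by (rule hol_cover_common_extension[OF assms x])
  from this(1) local_extension_linear_combination[OF this(2,3)]
  show "\<exists>U V F. x \<in> U \<and> local_extension \<Omega> p (\<lambda>y. a * f y + b * g y) U V F"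
    by (intro exI conjI)
qed

section \<open>Charts of the covering space and restricted operators\<close>

locale quadric_cover =
  fixes \<Omega> :: "'a::topological_space set" and p :: "'a \<Rightarrow> complex^3" and \<sigma> \<kappa> :: "complex poly"
  assumes cover: "covering_space \<Omega> p (quadric_manifold \<sigma>)"
    and degree: "degree \<sigma> \<le> 2" "degree \<kappa> \<le> 1"
begin

abbreviation "res \<equiv> restriction \<Omega> p"

lemma p_in_quadric: "x \<in> \<Omega> \<Longrightarrow> p x \<in> quadric_manifold \<sigma>"
  using covering_space_imp_surjective[OF cover] by blast

lemma quadric_point_wz: "x \<in> \<Omega> \<Longrightarrow> quadric_point \<sigma> (wz p x) = p x"
  using homeomorphism_apply1[OF homeomorphism_tz p_in_quadric] by (simp add: wz_eq_tz)

lemma wz_in_domain: "x \<in> \<Omega> \<Longrightarrow> wz p x \<in> coord_domain \<sigma>"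
  using homeomorphism_image1[OF homeomorphism_tz] p_in_quadric by (auto simp: wz_eq_tz)

lemma continuous_on_wz: "continuous_on \<Omega> (wz p)"
  unfolding wz_eq_tz
  using covering_space_imp_continuous[OF cover] homeomorphism_cont1[OF homeomorphism_tz]
    covering_space_imp_surjective[OF cover] by (metis continuous_on_compose)

text \<open>A local inverse of p is composed with the global coordinates of the quadric. The image
  is open in the plane of (w, z) because \<open>coord_domain\<close> is.\<close>

lemma chart_exists:
  assumes "x \<in> \<Omega>"
  obtains U W \<psi> where "x \<in> U" "wz_chart \<Omega> p U W \<psi>"
proof -
  obtain T u q where T: "x \<in> T" "openin (top_of_set \<Omega>) T"
      "openin (top_of_set (quadric_manifold \<sigma>)) u" "homeomorphism T u p q"
    using covering_space_local_homeomorphism[OF cover assms] by metis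
  have "u \<subseteq> quadric_manifold \<sigma>" using T(3) openin_imp_subset by blast
  then have "homeomorphism u (tz ` u) tz (quadric_point \<sigma>)"
    using homeomorphism_of_subsets[OF homeomorphism_tz] homeomorphism_image1[OF homeomorphism_tz] by blast
  from homeomorphism_compose[OF T(4) this]
  have "homeomorphism T (tz ` u) (wz p) (q \<circ> quadric_point \<sigma>)" by (simp add: wz_eq_tz)
  moreover have "open (tz ` u)"
    using homeomorphism_imp_open_map[OF homeomorphism_tz T(3)] open_coord_domain
    by (metis openin_open_trans)
  ultimately show ?thesis using that[of T "tz ` u" "q \<circ> quadric_point \<sigma>"] T by (simp add: wz_chart_def)
qed

text \<open>The decisive clause is the one on \<open>p (\<psi> u)\<close>: whichever sheet a chart
  lies on, p reads there as the same parametrization of the quadric.\<close>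

lemma chartD:
  assumes "wz_chart \<Omega> p U W \<psi>" "u \<in> W"
  shows "\<psi> u \<in> U" "\<psi> u \<in> \<Omega>" "wz p (\<psi> u) = u" "p (\<psi> u) = quadric_point \<sigma> u" "u$1 \<noteq> 0"
proof -
  have h: "homeomorphism U W (wz p) \<psi>" and "U \<subseteq> \<Omega>"
    using assms(1) openin_imp_subset by (auto simp: wz_chart_def)
  then show "\<psi> u \<in> U" "\<psi> u \<in> \<Omega>" "wz p (\<psi> u) = u"
    using assms(2) homeomorphism_image2[OF h] homeomorphism_apply2[OF h] by auto
  then show "p (\<psi> u) = quadric_point \<sigma> u" "u$1 \<noteq> 0"
    using quadric_point_wz wz_in_domain by (fastforce simp: coord_domain_def)+
qed

lemma chart_inv:
  assumes "wz_chart \<Omega> p U W \<psi>" "x \<in> U"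
  shows "wz p x \<in> W" "\<psi> (wz p x) = x" "x \<in> \<Omega>"
  using assms openin_imp_subset homeomorphism_image1 homeomorphism_apply1
  by (fastforce simp: wz_chart_def)+

lemma chart_open: "wz_chart \<Omega> p U W \<psi> \<Longrightarrow> open W"
  by (simp add: wz_chart_def)

lemma chart_preimage_open:
  assumes "wz_chart \<Omega> p U W \<psi>" "openin (top_of_set \<Omega>) T"
  shows "open (W \<inter> \<psi> -` T)"
proof -
  have "continuous_on W \<psi>" using assms(1) homeomorphism_cont2 by (auto simp: wz_chart_def)
  moreover have "\<psi> \<in> W \<rightarrow> \<Omega>" using chartD(2)[OF assms(1)] by auto
  ultimately have "openin (top_of_set W) (W \<inter> \<psi> -` T)"
    using assms(2) continuous_openin_preimage by blast
  then show ?thesis using chart_open[OF assms(1)] openin_open_trans by blast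
qed

text \<open>Well-definedness in one chart: the right-hand side of the second claim does not mention
  \<open>F\<close>. The functions compared agree only on the part of \<open>W\<close> lying over
  \<open>T\<close>, which is open and hence large enough for derivatives.\<close>

lemma extension_in_chart:
  assumes ext: "local_extension \<Omega> p f T V F" and chart: "wz_chart \<Omega> p U W \<psi>"
    and u: "u \<in> W" "\<psi> u \<in> T"
  shows "cdiff_at (f \<circ> \<psi>) u"
    "(D, D') \<in> op_pairs \<sigma> \<kappa> \<Longrightarrow> D F (p (\<psi> u)) = D' (f \<circ> \<psi>) u"
proof -
  note e = local_extensionD[OF ext]
  note c = chartD[OF chart]
  have S: "open (W \<inter> \<psi> -` T)" "u \<in> W \<inter> \<psi> -` T"
    using chart_preimage_open[OF chart e(1)] u by auto
  have eq: "F (quadric_point \<sigma> y) = (f \<circ> \<psi>) y" if "y \<in> W \<inter> \<psi> -` T" for y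
    using that e(7) c(4) by auto
  have F: "cdiff_at F (quadric_point \<sigma> u)"
    using e(4,6) u c(4) hol_cdiff_at by metis
  have cd: "cdiff_at (\<lambda>u. F (quadric_point \<sigma> u)) u"
    by (rule cdiff_at_chain(1)[OF cdiff_at_quadric_point_nth[OF c(5)[OF u(1)]] F])
  show "cdiff_at (f \<circ> \<psi>) u"
    by (rule cdiff_at_cong_open(1)[OF S _ cd]) (rule eq)
  show "D F (p (\<psi> u)) = D' (f \<circ> \<psi>) u" if "(D, D') \<in> op_pairs \<sigma> \<kappa>"
    using op_quadric_point[OF c(5)[OF u(1)] F that] ops2_cong[where G="f \<circ> \<psi>", OF S eq cd that] c(4)[OF u(1)] by simp
qed

text \<open>Two extensions near x are compared in a single chart around x, where both give
  \<open>D' (f \<circ> \<psi>)\<close>. So the definite description has a unique witness.\<close>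

lemma res_eq:
  assumes ext: "local_extension \<Omega> p f T V F" and x: "x \<in> T" and D: "(D, D') \<in> op_pairs \<sigma> \<kappa>"
  shows "res D f x = D F (p x)"
  unfolding restriction_def
proof (rule the_equality)
  show "\<exists>U V F'. x \<in> U \<and> local_extension \<Omega> p f U V F' \<and> D F (p x) = D F' (p x)"
    using ext x by blast
next
  fix d assume "\<exists>U V F. x \<in> U \<and> local_extension \<Omega> p f U V F \<and> d = D F (p x)"
  then obtain T' V' F' where ext': "x \<in> T'" "local_extension \<Omega> p f T' V' F'" "d = D F' (p x)" by blast
  obtain U W \<psi> where chart: "x \<in> U" "wz_chart \<Omega> p U W \<psi>"
    using chart_exists x local_extensionD(5)[OF ext] by blast
  note c = chart_inv[OF chart(2,1)]
  show "d = D F (p x)"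
    using extension_in_chart(2)[OF ext chart(2) c(1) _ D] extension_in_chart(2)[OF ext'(2) chart(2) c(1) _ D]
      x ext' c(2) by simp
qed

text \<open>Keeping the domains unchanged makes restrictions iterable: a product of restricted
  operators is computed on the same extension.\<close>

lemma local_extension_res:
  assumes ext: "local_extension \<Omega> p f T V F" and D: "(D, D') \<in> op_pairs \<sigma> \<kappa>"
  shows "local_extension \<Omega> p (res D f) T V (D F)"
proof -
  have "D F \<in> hol V"
    by (rule ops3_hol[where \<sigma>=\<sigma> and \<kappa>=\<kappa>]) (use local_extensionD[OF ext] D in \<open>auto simp: op_pairs_def\<close>)
  then show ?thesis
    using ext res_eq[OF ext _ D] by (auto simp: local_extension_def)
qed

lemma res_hol_cover:
  assumes D: "(D, D') \<in> op_pairs \<sigma> \<kappa>" and f: "f \<in> hol_cover \<Omega> p"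
  shows "res D f \<in> hol_cover \<Omega> p"
  unfolding hol_cover_def
proof (intro CollectI ballI)
  fix x assume x: "x \<in> \<Omega>"
  obtain U V F where "x \<in> U" "local_extension \<Omega> p f U V F"
    by (rule hol_coverE[OF f x])
  from this(1) local_extension_res[OF this(2) D]
  show "\<exists>U V F. x \<in> U \<and> local_extension \<Omega> p (res D f) U V F"
    by (intro exI conjI)
qed

lemma restricts: "(D, D') \<in> op_pairs \<sigma> \<kappa> \<Longrightarrow> restricts \<Omega> p D"
  unfolding restricts_def using res_hol_cover res_eq by blast

lemma hol_cover_iff:
  "f \<in> hol_cover \<Omega> p \<longleftrightarrow> (\<forall>U W \<psi>. wz_chart \<Omega> p U W \<psi> \<longrightarrow> f \<circ> \<psi> \<in> hol W)"
proof (intro iffI allI impI)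
  fix U W \<psi> assume f: "f \<in> hol_cover \<Omega> p" and chart: "wz_chart \<Omega> p U W \<psi>"
  have "cdiff_at (f \<circ> \<psi>) u" if "u \<in> W" for u
    using hol_coverE[OF f chartD(2)[OF chart that]] extension_in_chart(1)[OF _ chart that] by blast
  then show "f \<circ> \<psi> \<in> hol W" by (simp add: hol_iff_cdiff_at)
next
  assume f: "\<forall>U W \<psi>. wz_chart \<Omega> p U W \<psi> \<longrightarrow> f \<circ> \<psi> \<in> hol W"
  show "f \<in> hol_cover \<Omega> p"
    unfolding hol_cover_def
  proof (intro CollectI ballI)
    fix x assume "x \<in> \<Omega>"
    then obtain U W \<psi> where chart: "x \<in> U" "wz_chart \<Omega> p U W \<psi>"
      using chart_exists by blast
    \<comment> \<open>\<open>V\<close> is the cylinder over \<open>W\<close> in the s-direction, cut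
      down to nonzero t as \<open>local_extension\<close> demands.\<close>
    define V where "V = tz -` W \<inter> t_nonzero"
    have "open V"
      unfolding V_def t_nonzero_def using chart_open[OF chart(2)] continuous_on_tz
      by (intro open_Int open_vimage open_Collect_neq continuous_intros) auto
    moreover have "(\<lambda>v. (f \<circ> \<psi>) (tz v)) \<in> hol V"
      unfolding hol_iff_cdiff_at
    proof
      fix v assume v: "v \<in> V"
      have "cdiff_at (\<lambda>v. tz v $ k) v" for k
        using exhaust_2[of k] by auto
      moreover have "cdiff_at (f \<circ> \<psi>) (tz v)"
        using f chart(2) v by (auto simp: V_def intro: hol_cdiff_at)
      ultimately show "cdiff_at (\<lambda>v. (f \<circ> \<psi>) (tz v)) v" by (rule cdiff_at_chain(1))
    qed
    moreover have "p y \<in> V \<and> f y = (f \<circ> \<psi>) (tz (p y))" if "y \<in> U" for y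
      using chart_inv[OF chart(2) that] wz_in_domain[of y]
      by (auto simp: V_def t_nonzero_def wz_eq_tz coord_domain_def)
    ultimately have "local_extension \<Omega> p f U V (\<lambda>v. (f \<circ> \<psi>) (tz v))"
      using chart(2) by (auto simp: local_extension_def wz_chart_def V_def)
    with chart(1) show "\<exists>U V F. x \<in> U \<and> local_extension \<Omega> p f U V F" by blast
  qed
qed

lemma res_in_chart:
  assumes f: "f \<in> hol_cover \<Omega> p" and chart: "wz_chart \<Omega> p U W \<psi>" and u: "u \<in> W"
    and D: "(D, D') \<in> op_pairs \<sigma> \<kappa>"
  shows "res D f (\<psi> u) = D' (f \<circ> \<psi>) u"
proof -
  obtain T V F where ext: "\<psi> u \<in> T" "local_extension \<Omega> p f T V F"
    using hol_coverE[OF f chartD(2)[OF chart u]] by blast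
  then show ?thesis
    using res_eq[OF ext(2,1) D] extension_in_chart(2)[OF ext(2) chart u ext(1) D] by simp
qed

text \<open>The coordinate formula for the inner operator holds on all of \<open>W\<close>, so it
  may be inserted under the derivatives of the outer one.\<close>

lemma res_res_in_chart:
  assumes f: "f \<in> hol_cover \<Omega> p" and chart: "wz_chart \<Omega> p U W \<psi>" and u: "u \<in> W"
    and D: "(D, D') \<in> op_pairs \<sigma> \<kappa>" and E: "(E, E') \<in> op_pairs \<sigma> \<kappa>"
  shows "res D (res E f) (\<psi> u) = D' (E' (f \<circ> \<psi>)) u"
proof -
  have Ef: "res E f \<in> hol_cover \<Omega> p" by (rule res_hol_cover[OF E f])
  have "cdiff_at (res E f \<circ> \<psi>) u"
    using Ef hol_cover_iff chart u hol_cdiff_at by blast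
  moreover have "(res E f \<circ> \<psi>) y = E' (f \<circ> \<psi>) y" if "y \<in> W" for y
    using res_in_chart[OF f chart that E] by simp
  ultimately have "D' (res E f \<circ> \<psi>) u = D' (E' (f \<circ> \<psi>)) u"
    using ops2_cong[OF chart_open[OF chart] u _ _ D] by blast
  then show ?thesis using res_in_chart[OF Ef chart u D] by simp
qed

lemma op_pairs_mem:
  "(N_op, N_wz) \<in> op_pairs \<sigma> \<kappa>" "(Ap_op \<sigma>, Ap_wz) \<in> op_pairs \<sigma> \<kappa>" "(Am_op \<sigma> \<kappa>, Am_wz \<sigma> \<kappa>) \<in> op_pairs \<sigma> \<kappa>"
  by (auto simp: op_pairs_def)

section \<open>The Casimir operator and the representation on the cover\<close>

abbreviation "C \<equiv> casimir (const_deriv2 \<sigma> / 2) (const_deriv \<kappa>) (res N_op) (res (Ap_op \<sigma>)) (res (Am_op \<sigma> \<kappa>))"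

lemma casimir_in_chart:
  assumes f: "f \<in> hol_cover \<Omega> p" and chart: "wz_chart \<Omega> p U W \<psi>" and u: "u \<in> W"
  shows "C f (\<psi> u) = casimir_wz \<sigma> \<kappa> (f \<circ> \<psi>) u"
proof -
  have "f \<circ> \<psi> \<in> hol W" using f chart hol_cover_iff by blast
  note casimir_wz_eq[OF chart_open[OF chart] u this chartD(5)[OF chart u] degree, symmetric]
  then show ?thesis
    by (simp add: casimir_def res_in_chart[OF f chart u op_pairs_mem(1)]
        res_res_in_chart[OF f chart u op_pairs_mem(1) op_pairs_mem(1)]
        res_res_in_chart[OF f chart u op_pairs_mem(2) op_pairs_mem(3)]
        res_res_in_chart[OF f chart u op_pairs_mem(3) op_pairs_mem(2)])
qed

text \<open>Passes the bracket relations from three-space to \<Omega> without a second computation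
  in charts.\<close>

lemma res_commutator:
  assumes "(D, D') \<in> op_pairs \<sigma> \<kappa>" "(E, E') \<in> op_pairs \<sigma> \<kappa>" "local_extension \<Omega> p f T V F" "x \<in> T"
  shows "commutator (res D) (res E) f x = commutator D E F (p x)"
  unfolding commutator_def
  using res_eq[OF local_extension_res[OF assms(3,2)] assms(4,1)]
    res_eq[OF local_extension_res[OF assms(3,1)] assms(4,2)] by simp

lemma cover_representation:
  "m_representation (const_deriv2 \<sigma> / 2) (const_deriv \<kappa>) \<Omega> (hol_cover \<Omega> p)
    (m_action (res N_op) (res (Ap_op \<sigma>)) (res (Am_op \<sigma> \<kappa>)))"
proof (rule m_representationI)
  fix f g :: "'a \<Rightarrow> complex" and a b assume "f \<in> hol_cover \<Omega> p" "g \<in> hol_cover \<Omega> p"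
  then show "(\<lambda>y. a * f y + b * g y) \<in> hol_cover \<Omega> p" by (rule hol_cover_linear_combination)
next
  fix D f assume "D \<in> {res N_op, res (Ap_op \<sigma>), res (Am_op \<sigma> \<kappa>)}" "f \<in> hol_cover \<Omega> p"
  then show "D f \<in> hol_cover \<Omega> p" using res_hol_cover op_pairs_mem by blast
next
  fix D f g x
  assume "D \<in> {res N_op, res (Ap_op \<sigma>), res (Am_op \<sigma> \<kappa>)}" and f: "f \<in> hol_cover \<Omega> p"
    and eq: "\<forall>x\<in>\<Omega>. f x = g x" and x: "x \<in> \<Omega>"
  then obtain E E' where E: "(E, E') \<in> op_pairs \<sigma> \<kappa>" "D = res E" using op_pairs_mem by blast
  obtain T V F where ext: "x \<in> T" "local_extension \<Omega> p f T V F"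
    using hol_coverE[OF f x] by blast
  then have "local_extension \<Omega> p g T V F" using eq local_extension_cong by blast
  then show "D f x = D g x" using res_eq[OF _ ext(1) E(1)] ext(2) E(2) by metis
next
  fix D f g a b x
  assume "D \<in> {res N_op, res (Ap_op \<sigma>), res (Am_op \<sigma> \<kappa>)}" and f: "f \<in> hol_cover \<Omega> p"
    and g: "g \<in> hol_cover \<Omega> p" and x: "x \<in> \<Omega>"
  then obtain E E' where E: "(E, E') \<in> op_pairs \<sigma> \<kappa>" "D = res E" using op_pairs_mem by blast
  obtain T V F G where ext: "x \<in> T" "local_extension \<Omega> p f T V F" "local_extension \<Omega> p g T V G"
    using hol_cover_common_extension[OF f g x] by blast
  have cd: "cdiff_at F (p x)" "cdiff_at G (p x)"
    using local_extensionD(4,6)[OF ext(2)] local_extensionD(4)[OF ext(3)] ext(1) hol_cdiff_at by blast+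
  have "E (\<lambda>y. a * F y + b * G y) (p x) = a * E F (p x) + b * E G (p x)"
    by (rule ops3_linear[where \<sigma>=\<sigma> and \<kappa>=\<kappa>, OF _ cd])
      (use E(1) in \<open>auto simp: op_pairs_def\<close>)
  then show "D (\<lambda>y. a * f y + b * g y) x = a * D f x + b * D g x"
    using res_eq[OF _ ext(1) E(1)] ext(2,3) local_extension_linear_combination[OF ext(2,3), of a b] E(2)
    by metis
next
  fix f x assume f: "f \<in> hol_cover \<Omega> p" and x: "x \<in> \<Omega>"
  obtain T V F where ext: "x \<in> T" "local_extension \<Omega> p f T V F"
    using hol_coverE[OF f x] by blast
  note e = local_extensionD[OF ext(2)]
  note comm = ops3_commutators[OF e(2-4) e(6)[OF ext(1)] degree]
  show "commutator (res N_op) (res (Ap_op \<sigma>)) f x = res (Ap_op \<sigma>) f x"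
    "commutator (res N_op) (res (Am_op \<sigma> \<kappa>)) f x = - res (Am_op \<sigma> \<kappa>) f x"
    "commutator (res (Ap_op \<sigma>)) (res (Am_op \<sigma> \<kappa>)) f x =
      2 * (const_deriv2 \<sigma> / 2) * res N_op f x + const_deriv \<kappa> * f x"
    using comm e(7)[OF ext(1)] op_pairs_mem[THEN res_eq[OF ext(2,1)]]
      res_commutator[OF op_pairs_mem(1) op_pairs_mem(2) ext(2,1)]
      res_commutator[OF op_pairs_mem(1) op_pairs_mem(3) ext(2,1)]
      res_commutator[OF op_pairs_mem(2) op_pairs_mem(3) ext(2,1)]
    by simp_all
qed

lemma C_hol_cover:
  assumes f: "f \<in> hol_cover \<Omega> p"
  shows "C f \<in> hol_cover \<Omega> p"
proof -
  let ?N = "res N_op" and ?P = "res (Ap_op \<sigma>)" and ?M = "res (Am_op \<sigma> \<kappa>)"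
  \<comment> \<open>The factors 1 give the expression the exact shape of nested combinations
    \<open>a * F y + b * G y\<close>.\<close>
  have "(\<lambda>x. 1 * (1/2 * ?M (?P f) x + 1/2 * ?P (?M f) x)
      + 1 * (const_deriv2 \<sigma> / 2 * ?N (?N f) x + const_deriv \<kappa> * ?N f x)) \<in> hol_cover \<Omega> p"
    by (intro hol_cover_linear_combination res_hol_cover[OF op_pairs_mem(1)]
        res_hol_cover[OF op_pairs_mem(2)] res_hol_cover[OF op_pairs_mem(3)] f)
  moreover have "C f = (\<lambda>x. 1 * (1/2 * ?M (?P f) x + 1/2 * ?P (?M f) x)
      + 1 * (const_deriv2 \<sigma> / 2 * ?N (?N f) x + const_deriv \<kappa> * ?N f x))"
    by (auto simp: casimir_def[abs_def] algebra_simps)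
  ultimately show ?thesis by simp
qed

section \<open>The eigenspace N = 0\<close>

lemma function_of_z_in_chart:
  assumes f: "function_of_z \<Omega> p f T Z h" and chart: "wz_chart \<Omega> p U W \<psi>"
  shows "open (W \<inter> \<psi> -` T)" "open Z" "h holomorphic_on Z"
    "\<And>y. y \<in> W \<inter> \<psi> -` T \<Longrightarrow> y$2 \<in> Z"
    "\<And>y. y \<in> W \<inter> \<psi> -` T \<Longrightarrow> (f \<circ> \<psi>) y = h (y$2)"
  using f chart_preimage_open[OF chart, of T] chartD(4)[OF chart]
  by (fastforce simp: function_of_z_def)+

lemma C_function_of_z:
  assumes f: "f \<in> hol_cover \<Omega> p" "function_of_z \<Omega> p f T Z h" "x \<in> T"
  shows "C f x = H_op \<sigma> \<kappa> h (p x $ 3)"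
proof -
  have "x \<in> \<Omega>" using f openin_imp_subset by (auto simp: function_of_z_def)
  then obtain U W \<psi> where chart: "x \<in> U" "wz_chart \<Omega> p U W \<psi>"
    using chart_exists by blast
  note c = chart_inv[OF chart(2,1)]
  note z = function_of_z_in_chart[OF f(2) chart(2)]
  have "C f (\<psi> (wz p x)) = casimir_wz \<sigma> \<kappa> (f \<circ> \<psi>) (wz p x)"
    by (rule casimir_in_chart[OF f(1) chart(2) c(1)])
  also have "\<dots> = H_op \<sigma> \<kappa> h (wz p x $ 2)"
    by (rule casimir_wz_function_of_z[OF z(1) _ z(5,3,2,4)]) (use c f(3) in auto)
  finally show ?thesis using c by (simp add: wz_eq_tz)
qed

lemma N_zero_if_function_of_z:
  assumes f: "f \<in> hol_cover \<Omega> p" "function_of_z \<Omega> p f T Z h" "x \<in> T"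
  shows "res N_op f x = 0"
proof -
  have "x \<in> \<Omega>" using f openin_imp_subset by (auto simp: function_of_z_def)
  then obtain U W \<psi> where chart: "x \<in> U" "wz_chart \<Omega> p U W \<psi>"
    using chart_exists by blast
  note c = chart_inv[OF chart(2,1)]
  note z = function_of_z_in_chart[OF f(2) chart(2)]
  have x: "wz p x \<in> W \<inter> \<psi> -` T" using c f(3) by auto
  have "(h has_field_derivative deriv h (wz p x $ 2)) (at (wz p x $ 2))"
    by (rule holomorphic_derivI[OF z(3,2) z(4)[OF x]])
  note pd = pd_function_of_z[OF this]
  have "pd 1 (f \<circ> \<psi>) (wz p x) = 0"
    using cdiff_at_cong_open(2)[where G="f \<circ> \<psi>", OF z(1) x z(5)[symmetric] pd(1)] pd(2) by simp
  then show ?thesis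
    using res_in_chart[OF f(1) chart(2) c(1) op_pairs_mem(1)] c(2) by (simp add: N_wz_def)
qed

text \<open>In a chart N f = 0 says that the w-derivative vanishes. This gives constancy only along
  connected w-slices, so the chart is shrunk to a product of two discs.\<close>

lemma function_of_z_if_N_zero:
  assumes f: "f \<in> hol_cover \<Omega> p" and N: "\<forall>x\<in>\<Omega>. res N_op f x = 0" and x: "x \<in> \<Omega>"
  shows "\<exists>U Z h. x \<in> U \<and> function_of_z \<Omega> p f U Z h"
proof -
  obtain U W \<psi> where chart: "x \<in> U" "wz_chart \<Omega> p U W \<psi>"
    using chart_exists x by blast
  define G where "G = f \<circ> \<psi>"
  define u0 where "u0 = wz p x"
  have u0: "u0 \<in> W" using chart_inv(1)[OF chart(2,1)] by (simp add: u0_def)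
  have G: "G \<in> hol W" using f chart(2) hol_cover_iff G_def by blast
  \<comment> \<open>The factor w in \<open>N_wz\<close> can be cancelled, since w does not vanish on
    a chart.\<close>
  have pd0: "pd 1 G u = 0" if "u \<in> W" for u
    using res_in_chart[OF f chart(2) that op_pairs_mem(1)] N chartD[OF chart(2) that]
    by (simp add: N_wz_def G_def)
  obtain e where e: "e > 0" "ball u0 e \<subseteq> W"
    using chart_open[OF chart(2)] u0 open_contains_ball by blast
  \<comment> \<open>Radius e/2 suffices because the norm is at most the sum of the two coordinate
    distances, so \<open>B\<close> lies inside the ball of radius e.\<close>
  define B where "B = {u :: complex^2. dist (u0$1) (u$1) < e/2 \<and> dist (u0$2) (u$2) < e/2}"
  have "B \<subseteq> W"
  proof
    fix u assume "u \<in> B"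
    have "norm (u0 - u) \<le> (\<Sum>i\<in>UNIV. norm ((u0 - u) $ i))"
      unfolding norm_vec_def by (rule L2_set_le_sum) simp
    also have "\<dots> < e" using \<open>u \<in> B\<close> by (simp add: sum_2 B_def dist_norm)
    finally show "u \<in> W" using e(2) by (auto simp: dist_norm)
  qed
  have "open B"
    unfolding B_def by (intro open_Collect_conj open_Collect_less continuous_intros)
  define Z where "Z = ball (u0$2) (e/2)"
  \<comment> \<open>The slice through the centre: w is frozen at \<open>u0$1\<close>.\<close>
  define h where "h z = G (vector [u0$1, z])" for z
  \<comment> \<open>These forms match \<open>cdiff_at_DERIV\<close>, with the varying coordinate as
    the parameter along an axis.\<close>
  have vec1: "vector [a, z] = vector [0, z] + axis (1::2) a" for a z :: complex
    by (simp add: vec_eq_iff forall_2 axis_def)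
  have vec2: "vector [a, z] = vector [a, 0] + axis (2::2) z" for a z :: complex
    by (simp add: vec_eq_iff forall_2 axis_def)
  have BI: "vector [a, z] \<in> B" if "a \<in> ball (u0$1) (e/2)" "z \<in> Z" for a z
    using that by (simp add: B_def Z_def)
  have "h holomorphic_on Z"
  proof (rule holomorphic_onI)
    fix z assume "z \<in> Z"
    then have "cdiff_at G (vector [u0$1, 0] + axis 2 z)"
      using BI[of "u0$1" z] \<open>B \<subseteq> W\<close> e(1) hol_cdiff_at[OF G] vec2[of "u0$1" z] by auto
    from cdiff_at_DERIV[OF this] show "h field_differentiable at z within Z"
      unfolding h_def[abs_def] vec2[symmetric]
      by (meson field_differentiable_at_within field_differentiable_def)
  qed
  moreover have "G u = h (u$2)" if "u \<in> B" for u
  proof -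
    have u: "u$1 \<in> ball (u0$1) (e/2)" "u$2 \<in> Z" using that by (auto simp: B_def Z_def)
    \<comment> \<open>For fixed z the function of w has zero derivative on a disc, which is convex,
      so its values at \<open>u$1\<close> and at the centre \<open>u0$1\<close> coincide.\<close>
    have "\<exists>c. \<forall>a\<in>ball (u0$1) (e/2). G (vector [a, u$2]) = c"
    proof (rule has_field_derivative_zero_constant)
      fix a assume "a \<in> ball (u0$1) (e/2)"
      then have a: "vector [a, u$2] \<in> W" using BI u(2) \<open>B \<subseteq> W\<close> by blast
      then have "cdiff_at G (vector [0, u$2] + axis 1 a)"
        using hol_cdiff_at[OF G] vec1[of a "u$2"] by simp
      from cdiff_at_DERIV[OF this]
      have "((\<lambda>a. G (vector [a, u$2])) has_field_derivative 0) (at a)"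
        unfolding vec1[symmetric] pd0[OF a] .
      then show "((\<lambda>a. G (vector [a, u$2])) has_field_derivative 0) (at a within ball (u0$1) (e/2))"
        by (rule has_field_derivative_at_within)
    qed simp
    then have "G (vector [u$1, u$2]) = G (vector [u0$1, u$2])" using u(1) e(1) by force
    moreover have "vector [u$1, u$2] = u" by (simp add: vec_eq_iff forall_2)
    ultimately show ?thesis by (simp add: h_def)
  qed
  moreover have "openin (top_of_set \<Omega>) (U \<inter> (\<Omega> \<inter> wz p -` B))"
    using chart(2) continuous_openin_preimage_gen[OF continuous_on_wz \<open>open B\<close>]
    by (auto simp: wz_chart_def)
  ultimately have "function_of_z \<Omega> p f (U \<inter> (\<Omega> \<inter> wz p -` B)) Z h"
    using chart_inv[OF chart(2)] unfolding function_of_z_def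
    by (fastforce simp: Z_def B_def G_def wz_eq_tz)
  moreover have "x \<in> U \<inter> (\<Omega> \<inter> wz p -` B)"
    using x chart(1) e(1) by (simp add: B_def u0_def)
  ultimately show ?thesis by (intro exI conjI)
qed

text \<open>Locally \<open>C f\<close> is again a holomorphic function of z alone, namely
  \<open>H_op\<close> applied to h, and such functions are annihilated by N. No commutation of the
  Casimir operator with N is invoked.\<close>

lemma N_C_zero:
  assumes f: "f \<in> hol_cover \<Omega> p" and N: "\<forall>x\<in>\<Omega>. res N_op f x = 0" and x: "x \<in> \<Omega>"
  shows "res N_op (C f) x = 0"
proof -
  obtain U Z h where z: "x \<in> U" "function_of_z \<Omega> p f U Z h"
    using function_of_z_if_N_zero[OF f N x] by blast
  then have "h holomorphic_on Z" "open Z" by (auto simp: function_of_z_def)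
  then have "(H_op \<sigma> \<kappa> h) holomorphic_on Z"
    unfolding H_op_def[abs_def]
    by (intro holomorphic_intros holomorphic_deriv poly_holomorphic_on) auto
  then have "function_of_z \<Omega> p (C f) U Z (H_op \<sigma> \<kappa> h)"
    using z(2) C_function_of_z[OF f z(2)] by (auto simp: function_of_z_def)
  then show ?thesis using N_zero_if_function_of_z C_hol_cover f z(1) by blast
qed

lemma restricted_operators:
  "restricts \<Omega> p N_op \<and> restricts \<Omega> p (Ap_op \<sigma>) \<and> restricts \<Omega> p (Am_op \<sigma> \<kappa>) \<and>
   (\<forall>x\<in>\<Omega>. \<exists>U W \<psi>. x \<in> U \<and> wz_chart \<Omega> p U W \<psi>) \<and>
   (\<forall>f. f \<in> hol_cover \<Omega> p \<longleftrightarrow> (\<forall>U W \<psi>. wz_chart \<Omega> p U W \<psi> \<longrightarrow> f \<circ> \<psi> \<in> hol W)) \<and>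
   (\<forall>f\<in>hol_cover \<Omega> p. \<forall>U W \<psi>. wz_chart \<Omega> p U W \<psi> \<longrightarrow> (\<forall>u\<in>W.
      res N_op f (\<psi> u) = N_wz (f \<circ> \<psi>) u \<and>
      res (Ap_op \<sigma>) f (\<psi> u) = Ap_wz (f \<circ> \<psi>) u \<and>
      res (Am_op \<sigma> \<kappa>) f (\<psi> u) = Am_wz \<sigma> \<kappa> (f \<circ> \<psi>) u))"
proof (intro conjI ballI)
  show "\<exists>U W \<psi>. x \<in> U \<and> wz_chart \<Omega> p U W \<psi>" if "x \<in> \<Omega>" for x
    using chart_exists[OF that] by metis
  show "\<forall>f. f \<in> hol_cover \<Omega> p \<longleftrightarrow> (\<forall>U W \<psi>. wz_chart \<Omega> p U W \<psi> \<longrightarrow> f \<circ> \<psi> \<in> hol W)"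
    by (intro allI hol_cover_iff)
  show "\<forall>U W \<psi>. wz_chart \<Omega> p U W \<psi> \<longrightarrow> (\<forall>u\<in>W.
      res N_op f (\<psi> u) = N_wz (f \<circ> \<psi>) u \<and>
      res (Ap_op \<sigma>) f (\<psi> u) = Ap_wz (f \<circ> \<psi>) u \<and>
      res (Am_op \<sigma> \<kappa>) f (\<psi> u) = Am_wz \<sigma> \<kappa> (f \<circ> \<psi>) u)" if "f \<in> hol_cover \<Omega> p" for f
    by (intro allI impI ballI conjI res_in_chart[OF that] op_pairs_mem)
qed (rule op_pairs_mem[THEN restricts])+

lemma casimir_of_restriction:
  "m_representation (const_deriv2 \<sigma> / 2) (const_deriv \<kappa>) \<Omega> (hol_cover \<Omega> p)
     (m_action (res N_op) (res (Ap_op \<sigma>)) (res (Am_op \<sigma> \<kappa>))) \<and>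
   (\<forall>f\<in>hol_cover \<Omega> p. \<forall>U W \<psi>. wz_chart \<Omega> p U W \<psi> \<longrightarrow>
      (\<forall>u\<in>W. C f (\<psi> u) = casimir_wz \<sigma> \<kappa> (f \<circ> \<psi>) u)) \<and>
   (\<forall>f\<in>hol_cover \<Omega> p.
      (\<forall>x\<in>\<Omega>. res N_op f x = 0) \<longleftrightarrow> (\<forall>x\<in>\<Omega>. \<exists>U Z h. x \<in> U \<and> function_of_z \<Omega> p f U Z h)) \<and>
   (\<forall>f\<in>hol_cover \<Omega> p. (\<forall>x\<in>\<Omega>. res N_op f x = 0) \<longrightarrow>
      (\<forall>x\<in>\<Omega>. res N_op (C f) x = 0) \<and>
      (\<forall>U Z h. function_of_z \<Omega> p f U Z h \<longrightarrow> (\<forall>x\<in>U. C f x = H_op \<sigma> \<kappa> h (p x $ 3))))"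
proof (intro conjI ballI allI impI iffI)
  fix f x assume "f \<in> hol_cover \<Omega> p" "\<forall>x\<in>\<Omega>. \<exists>U Z h. x \<in> U \<and> function_of_z \<Omega> p f U Z h" "x \<in> \<Omega>"
  then show "res N_op f x = 0" using N_zero_if_function_of_z by metis
qed (intro cover_representation casimir_in_chart function_of_z_if_N_zero N_C_zero C_function_of_z; assumption)+

end

theorem mainTheorem1:
  fixes \<sigma> \<kappa> :: "complex poly"
  assumes "degree \<sigma> \<le> 2" and "\<sigma> \<noteq> 0" and "degree \<kappa> \<le> 1"
  shows
    \<comment> \<open>(i)\<close>
    "(\<forall>U. open U \<and> U \<subseteq> t_nonzero \<longrightarrow>
        (\<forall>F\<in>hol U. \<forall>v\<in>U.
           commutator N_op (Ap_op \<sigma>) F v = Ap_op \<sigma> F v \<and>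
           commutator N_op (Am_op \<sigma> \<kappa>) F v = - Am_op \<sigma> \<kappa> F v \<and>
           commutator (Ap_op \<sigma>) (Am_op \<sigma> \<kappa>) F v = const_deriv2 \<sigma> * N_op F v + const_deriv \<kappa> * F v) \<and>
        m_representation (const_deriv2 \<sigma> / 2) (const_deriv \<kappa>) U (hol U)
          (m_action N_op (Ap_op \<sigma>) (Am_op \<sigma> \<kappa>)))
     \<and> \<comment> \<open>(ii)\<close>
     (\<forall>U D. open U \<and> U \<subseteq> t_nonzero \<and> D \<in> {N_op, Ap_op \<sigma>, Am_op \<sigma> \<kappa>} \<longrightarrow>
        (\<forall>F\<in>hol U. \<forall>v\<in>U. D (\<lambda>y. quadric \<sigma> y * F y) v = quadric \<sigma> v * D F v))
     \<and>
     (\<forall>(\<Omega> :: 'a::topological_space set) p. universal_cover \<Omega> p (quadric_manifold \<sigma>) \<longrightarrow>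
        restricts \<Omega> p N_op \<and> restricts \<Omega> p (Ap_op \<sigma>) \<and> restricts \<Omega> p (Am_op \<sigma> \<kappa>) \<and>
        (\<forall>x\<in>\<Omega>. \<exists>U W \<psi>. x \<in> U \<and> wz_chart \<Omega> p U W \<psi>) \<and>
        (\<forall>f. f \<in> hol_cover \<Omega> p \<longleftrightarrow> (\<forall>U W \<psi>. wz_chart \<Omega> p U W \<psi> \<longrightarrow> f \<circ> \<psi> \<in> hol W)) \<and>
        (\<forall>f\<in>hol_cover \<Omega> p. \<forall>U W \<psi>. wz_chart \<Omega> p U W \<psi> \<longrightarrow> (\<forall>u\<in>W.
           restriction \<Omega> p N_op f (\<psi> u) = N_wz (f \<circ> \<psi>) u \<and>
           restriction \<Omega> p (Ap_op \<sigma>) f (\<psi> u) = Ap_wz (f \<circ> \<psi>) u \<and>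
           restriction \<Omega> p (Am_op \<sigma> \<kappa>) f (\<psi> u) = Am_wz \<sigma> \<kappa> (f \<circ> \<psi>) u)))
     \<and> \<comment> \<open>(iii)\<close>
     (\<forall>(\<Omega> :: 'a::topological_space set) p. universal_cover \<Omega> p (quadric_manifold \<sigma>) \<longrightarrow>
        (let \<alpha> = const_deriv2 \<sigma> / 2; \<beta> = const_deriv \<kappa>;
             N = restriction \<Omega> p N_op;
             Ap = restriction \<Omega> p (Ap_op \<sigma>);
             Am = restriction \<Omega> p (Am_op \<sigma> \<kappa>);
             C = casimir \<alpha> \<beta> N Ap Am
         in m_representation \<alpha> \<beta> \<Omega> (hol_cover \<Omega> p) (m_action N Ap Am) \<and>
            (\<forall>f\<in>hol_cover \<Omega> p. \<forall>U W \<psi>. wz_chart \<Omega> p U W \<psi> \<longrightarrow>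
               (\<forall>u\<in>W. C f (\<psi> u) = casimir_wz \<sigma> \<kappa> (f \<circ> \<psi>) u)) \<and>
            (\<forall>f\<in>hol_cover \<Omega> p.
               (\<forall>x\<in>\<Omega>. N f x = 0) \<longleftrightarrow> (\<forall>x\<in>\<Omega>. \<exists>U Z h. x \<in> U \<and> function_of_z \<Omega> p f U Z h)) \<and>
            (\<forall>f\<in>hol_cover \<Omega> p. (\<forall>x\<in>\<Omega>. N f x = 0) \<longrightarrow>
               (\<forall>x\<in>\<Omega>. N (C f) x = 0) \<and>
               (\<forall>U Z h. function_of_z \<Omega> p f U Z h \<longrightarrow>
                  (\<forall>x\<in>U. C f x = H_op \<sigma> \<kappa> h (p x $ 3))))))"
proof -
  have cover: "quadric_cover \<Omega> p \<sigma> \<kappa>" if "universal_cover \<Omega> p (quadric_manifold \<sigma>)" for \<Omega> :: "'a set" and p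
    using that assms(1,3) by (simp add: universal_cover_def quadric_cover_def)
  show ?thesis
    unfolding Let_def
  proof ((rule conjI[OF _ conjI[OF _ conjI]]; intro allI impI), goal_cases)
    case (1 U)
    then have U: "open U" "U \<subseteq> t_nonzero" by auto
    show ?case
      by (intro conjI ballI ops3_commutators[OF U _ _ assms(1,3)] ops3_representation[OF U assms(1,3)])
  next
    case (2 U D)
    have "D (\<lambda>y. quadric \<sigma> y * F y) v = quadric \<sigma> v * D F v" if "F \<in> hol U" "v \<in> U" for F v
      by (rule ops3_commute_quadric[where \<kappa>=\<kappa>])
        (use 2 that hol_cdiff_at in \<open>auto simp: t_nonzero_def\<close>)
    then show ?case by blast
  next
    case (3 \<Omega> p)
    show ?case by (rule quadric_cover.restricted_operators[OF cover[OF 3]])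
  next
    case (4 \<Omega> p)
    show ?case by (rule quadric_cover.casimir_of_restriction[OF cover[OF 4]])
  qed
qed

end
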